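(* Let $\Phi,\Psi$ be invertible $N_x\times N_x$ matrices (time-independent linear fine- and coarse-grid time-stepping operators) such that $\|\Phi^{q}\|<1$ and $\|\Psi^{q}\|<1$ for some $q\ge 1$, let $k$ be the coarsening factor and $N_c$ the number of coarse-grid time points. Suppose $\Phi$ satisfies an F-TAP$_1$ with respect to $\Psi$ with constant $\varphi_F$, and an FCF-TAP$_1$ with respect to $\Psi$ with constant $\varphi_{FCF}$. Let $\mathbf{e}_i^{(F)},\mathbf{r}_i^{(F)}$ (resp. $\mathbf{e}_i^{(FCF)},\mathbf{r}_i^{(FCF)}$) be the error and residual after $i$ iterations of Parareal / two-level MGRiT with F-relaxation (resp. of two-level MGRiT with FCF-relaxation). (1) (Sufficient conditions.) For all iterations $i>1$ (with $\mathbf{r}_i\ne\mathbf{0}$), $$\frac{\|\mathbf{r}_{i+1}^{(F)}\|}{\|\mathbf{r}_i^{(F)}\|}=\frac{\|\mathbf{e}_{i+1}^{(F)}\|_{A^*A}}{\|\mathbf{e}_i^{(F)}\|_{A^*A}}<\varphi_F\left(1+\|\Psi^{N_c}\|\right),$$ $$\frac{\|\mathbf{r}_{i+1}^{(FCF)}\|}{\|\mathbf{r}_i^{(FCF)}\|}=\frac{\|\mathbf{e}_{i+1}^{(FCF)}\|_{A^*A}}{\|\mathbf{e}_i^{(FCF)}\|_{A^*A}}<\varphi_{FCF}\left(1+\|\Phi^{-k}\Psi^{N_c}\Phi^k\|\right).$$ Thus $\varphi_F(1+\|\Psi^{N_c}\|)<1$ and $\varphi_{FCF}(1+\|\Phi^{-k}\Psi^{N_c}\Phi^k\|)<1$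 are sufficient conditions for convergence (strict decrease of the error in the $A^*A$-norm) with F-relaxation and FCF-relaxation, respectively, on every iteration but one. (2) (Necessary conditions.) Assume additionally that $\Psi-\Phi^k$ is invertible and that $\varphi_F,\varphi_{FCF}$ are the smallest constants for which the F-TAP$_1$ and FCF-TAP$_1$ hold. Then for iterations $i>1$ the worst-case ratios (supremum over all initial errors with $\mathbf{r}_i\neq\mathbf{0}$) satisfy $$\frac{\varphi_F}{1+O(1/\sqrt{N_c})}\le\sup\frac{\|\mathbf{r}_{i+1}^{(F)}\|}{\|\mathbf{r}_i^{(F)}\|}=\sup\frac{\|\mathbf{e}_{i+1}^{(F)}\|_{A^*A}}{\|\mathbf{e}_i^{(F)}\|_{A^*A}},\qquad \frac{\varphi_{FCF}}{1+O(1/\sqrt{N_c})}\le\sup\frac{\|\mathbf{r}_{i+1}^{(FCF)}\|}{\|\mathbf{r}_i^{(FCF)}\|}=\sup\frac{\|\mathbf{e}_{i+1}^{(FCF)}\|_{A^*A}}{\|\mathbf{e}_i^{(FCF)}\|_{A^*A}}.$$ Thus $\varphi_F<1+O(1/\sqrt{N_c})$ and $\varphi_{FCF}<1+O(1/\sqrt{N_c})$ are necessary conditions for convergence (strict decrease of the error in the $A^*A$-norm for every initial error), with F-relaxation and FCF-relaxation respectively, on every iteration but one. (3) (Necessary conditions, $p$ iterations.) Assume that $\Phi$ and $\Psi$ commute and that either (i) $\Psi-\Phi^k$ is invertible, or (ii) $\Phi$ and $\Psi$ are diagonalizable. Let $p\ge 1$. If $p$ iterations of Parareal / two-level MGRiT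 with F-relaxation are convergent in the $A^*A$-norm, i.e. $\|\mathbf{e}_p^{(F)}\|_{A^*A}<\|\mathbf{e}_0\|_{A^*A}$ for every initial error $\mathbf{e}_0\ne\mathbf{0}$, then $\Phi$ satisfies an F-TAP$_p$ with respect to $\Psi$ with a constant $\varphi_{F,p}<1+O(1/\sqrt{N_c})$. Similarly, if $\|\mathbf{e}_p^{(FCF)}\|_{A^*A}<\|\mathbf{e}_0\|_{A^*A}$ for every $\mathbf{e}_0\neq\mathbf{0}$, then $\Phi$ satisfies an FCF-TAP$_p$ with respect to $\Psi$ with a constant $\varphi_{FCF,p}<1+O(1/\sqrt{N_c})$.
   Context: Norms: $\|\cdot\|$ is the Euclidean ($\ell^2$) vector norm and induced matrix norm; $\|\mathbf{e}\|_{A^*A}^2=\langle A^*A\mathbf{e},\mathbf{e}\rangle=\|A\mathbf{e}\|^2$. Temporal approximation property (TAP): $\Phi$ satisfies an F-TAP$_p$ with respect to $\Psi$ with constant $\varphi_{F,p}$ if for all vectors $\mathbf{v}$ $$\|(\Psi-\Phi^k)^p\mathbf{v}\|\le\varphi_{F,p}\min_{x\in[0,2\pi]}\|(I-e^{\mathrm{i}x}\Psi)^p\mathbf{v}\|,$$ and an FCF-TAP$_p$ with constant $\varphi_{FCF,p}$ if for all $\mathbf{v}$ $$\|(\Psi-\Phi^k)^p\mathbf{v}\|\le\varphi_{FCF,p}\min_{x\in[0,2\pi]}\|(\Phi^{-k}(I-e^{\mathrm{i}x}\Psi))^p\mathbf{v}\|.$$ Algorithm: there are $N=(N_c-1)k+1$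 time points $0,\dots,N-1$. The space-time system is $A\mathbf{u}=\mathbf{f}$, where $A$ is the $N\times N$ block matrix with blocks of size $N_x\times N_x$, identity blocks on the diagonal, $-\Phi$ on the first block subdiagonal and zeros elsewhere. C-points are the time points that are multiples of $k$ (so $N_c$ of them, including the first and last); all others are F-points. Ordering F-points first, $A=\begin{bmatrix} A_{ff} & A_{fc} \\ A_{cf} & A_{cc} \end{bmatrix}$. Let $B_\Delta$ be the $N_c\times N_c$ block matrix with identity diagonal blocks, $-\Psi$ on the first block subdiagonal and zeros elsewhere. Put $$M_F^{-1}=\begin{bmatrix} A_{ff}^{-1} & 0 \\ 0 & 0 \end{bmatrix},\quad M_C^{-1}=\begin{bmatrix} 0 & 0 \\ 0 & A_{cc}^{-1} \end{bmatrix},\quad M_{cgc}^{-1}=\begin{bmatrix} -A_{ff}^{-1}A_{fc} \\ I \end{bmatrix}B_\Delta^{-1}\begin{bmatrix} 0 & I \end{bmatrix}.$$ One iteration of Parareal / two-level MGRiT with F-relaxation maps the error $\mathbf{e}$ to $\mathcal{E}_F\mathbf{e}$, $\mathcal{E}_F=(I-M_{cgc}^{-1}A)(I-M_F^{-1}A)$; one iteration of two-level MGRiT with FCF-relaxation maps it to $\mathcal{E}_{FCF}\mathbf{e}$, $\mathcal{E}_{FCF}=\mathcal{E}_F(I-M_C^{-1}A)(I-M_F^{-1}A)$. Thus $\mathbf{e}_i=\mathcal{E}^i\mathbf{e}_0$, and the residual is $\mathbf{r}_i=A\mathbf{e}_i$. Convention: $O(1/\sqrt{N_c})$ denotes a nonnegative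 quantity bounded by $C/\sqrt{N_c}$ as $N_c\to\infty$ with $\Phi,\Psi,k$ and the iteration index $i$ or power $p$ held fixed ($\Phi$ and $\Psi$ do not depend on $N_c$). *)

theory Defs
  imports "HOL-Analysis.Analysis" "HOL-Library.Landau_Symbols"
begin

subsection \<open>Matrices acting in space\<close>

text \<open>
  The library power on \<open>complex^'n^'n\<close> is the entrywise one, so powers with respect to the matrix
  product \<open>**\<close> are defined here.
\<close>

definition matpow :: "complex^'n^'n \<Rightarrow> nat \<Rightarrow> complex^'n^'n" where
  "matpow M m = (((**) M) ^^ m) (mat 1)"

definition opnorm :: "complex^'n^'n \<Rightarrow> real" where
  "opnorm M = onorm ((*v) M)"

definition adjoint_mat :: "complex^'n^'n \<Rightarrow> complex^'n^'n" where
  "adjoint_mat M = map_matrix cnj (transpose M)"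

definition diagonalizable :: "complex^'n^'n \<Rightarrow> bool" where
  "diagonalizable M \<longleftrightarrow>
     (\<exists>P D :: complex^'n^'n. invertible P \<and> (\<forall>i j. i \<noteq> j \<longrightarrow> D $ i $ j = 0) \<and> M = P ** D ** matrix_inv P)"

text \<open>
  \<open>mat c\<close> is \<open>c\<close> times the identity, so \<open>mat c ** \<Psi>\<close> is the scalar multiple \<open>c \<Psi>\<close>. The infimum over
  the compact interval is attained by continuity, so it is the minimum.
\<close>

definition F_TAP :: "nat \<Rightarrow> nat \<Rightarrow> complex^'n^'n \<Rightarrow> complex^'n^'n \<Rightarrow> real \<Rightarrow> bool" where
  "F_TAP p k \<Phi> \<Psi> \<phi> \<longleftrightarrow>
     (\<forall>v. norm (matpow (\<Psi> - matpow \<Phi> k) p *v v)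
        \<le> \<phi> * (INF x\<in>{0..2*pi}.
                 norm (matpow (mat 1 - mat (exp (\<i> * of_real x)) ** \<Psi>) p *v v)))"

definition FCF_TAP :: "nat \<Rightarrow> nat \<Rightarrow> complex^'n^'n \<Rightarrow> complex^'n^'n \<Rightarrow> real \<Rightarrow> bool" where
  "FCF_TAP p k \<Phi> \<Psi> \<phi> \<longleftrightarrow>
     (\<forall>v. norm (matpow (\<Psi> - matpow \<Phi> k) p *v v)
        \<le> \<phi> * (INF x\<in>{0..2*pi}.
                 norm (matpow (matpow (matrix_inv \<Phi>) k
                                ** (mat 1 - mat (exp (\<i> * of_real x)) ** \<Psi>)) p *v v)))"

subsection \<open>Block vectors and block matrices\<close>

text \<open>
  The number of blocks varies inside the statements, so block vectors and block matrices are
  functions of natural-number block indices, extended by zero outside the intended finite index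
  sets; the one exception is the identity \<open>bid\<close>, whose extra diagonal blocks are never met by the
  sums, which run over the index sets only. A matrix product takes the set of inner indices as an explicit argument; this gives
  rectangular products and submatrices such as \<open>A\<^sub>f\<^sub>f\<close> without reordering the unknowns.
\<close>

type_synonym 'n bvec = "nat \<Rightarrow> complex^'n"
type_synonym 'n bmat = "nat \<Rightarrow> nat \<Rightarrow> complex^'n^'n"

definition block_vecs :: "nat \<Rightarrow> 'n::finite bvec set" where
  "block_vecs n = {v. \<forall>j\<ge>n. v j = 0}"

definition bzero :: "'n::finite bvec" where
  "bzero = (\<lambda>_. 0)"

definition bid :: "'n::finite bmat" where
  "bid = (\<lambda>i j. if i = j then mat 1 else 0)"

definition bminus :: "'n::finite bmat \<Rightarrow> 'n bmat \<Rightarrow> 'n bmat" where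
  "bminus X Y = (\<lambda>i j. X i j - Y i j)"

definition bmult :: "nat set \<Rightarrow> 'n::finite bmat \<Rightarrow> 'n bmat \<Rightarrow> 'n bmat" where
  "bmult S X Y = (\<lambda>i j. \<Sum>l\<in>S. X i l ** Y l j)"

definition bapply :: "nat \<Rightarrow> 'n::finite bmat \<Rightarrow> 'n bvec \<Rightarrow> 'n bvec" where
  "bapply n X v = (\<lambda>i. \<Sum>j<n. X i j *v v j)"

definition badjoint :: "'n::finite bmat \<Rightarrow> 'n bmat" where
  "badjoint X = (\<lambda>i j. adjoint_mat (X j i))"

text \<open>
  \<open>binv S X\<close> is the inverse of the square submatrix of \<open>X\<close> with block rows and block columns in \<open>S\<close>,
  embedded with zero blocks outside \<open>S \<times> S\<close>. It is used only for unit lower triangular submatrices,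
  for which this inverse exists; it is always unique when it exists.
\<close>

definition binv :: "nat set \<Rightarrow> 'n::finite bmat \<Rightarrow> 'n bmat" where
  "binv S X = (THE Y.
      (\<forall>i j. i \<notin> S \<or> j \<notin> S \<longrightarrow> Y i j = 0) \<and>
      (\<forall>i\<in>S. \<forall>j\<in>S. bmult S X Y i j = bid i j) \<and>
      (\<forall>i\<in>S. \<forall>j\<in>S. bmult S Y X i j = bid i j))"

definition bnorm :: "nat \<Rightarrow> 'n::finite bvec \<Rightarrow> real" where
  "bnorm n v = L2_set (\<lambda>j. norm (v j)) {..<n}"

definition binner :: "nat \<Rightarrow> 'n::finite bvec \<Rightarrow> 'n bvec \<Rightarrow> complex" where
  "binner n u v = (\<Sum>j<n. \<Sum>a\<in>UNIV. u j $ a * cnj (v j $ a))"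

definition bidiag :: "nat \<Rightarrow> complex^'n^'n \<Rightarrow> 'n::finite bmat" where
  "bidiag n M = (\<lambda>i j. if i < n \<and> j < n
                       then (if i = j then mat 1 else if i = Suc j then - M else 0) else 0)"

subsection \<open>Parareal and two-level MGRiT\<close>

definition num_times :: "nat \<Rightarrow> nat \<Rightarrow> nat" where
  "num_times k Nc = (Nc - 1) * k + 1"

definition C_points :: "nat \<Rightarrow> nat \<Rightarrow> nat set" where
  "C_points k Nc = {i. i < num_times k Nc \<and> k dvd i}"

definition F_points :: "nat \<Rightarrow> nat \<Rightarrow> nat set" where
  "F_points k Nc = {i. i < num_times k Nc \<and> \<not> k dvd i}"

definition system_mat :: "nat \<Rightarrow> nat \<Rightarrow> complex^'n^'n \<Rightarrow> 'n::finite bmat" where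
  "system_mat k Nc \<Phi> = bidiag (num_times k Nc) \<Phi>"

definition MF_inv :: "nat \<Rightarrow> nat \<Rightarrow> complex^'n^'n \<Rightarrow> 'n::finite bmat" where
  "MF_inv k Nc \<Phi> = binv (F_points k Nc) (system_mat k Nc \<Phi>)"

definition MC_inv :: "nat \<Rightarrow> nat \<Rightarrow> complex^'n^'n \<Rightarrow> 'n::finite bmat" where
  "MC_inv k Nc \<Phi> = binv (C_points k Nc) (system_mat k Nc \<Phi>)"

text \<open>
  Coarse block index \<open>J < Nc\<close> corresponds to the C-point \<open>J * k\<close>. \<open>interp\<close> is the block column with
  F-rows \<open>- A\<^sub>f\<^sub>f\<close>-inverse times \<open>A\<^sub>f\<^sub>c\<close> and C-rows the identity; \<open>inject\<close> is the block row \<open>[0 I]\<close>.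
\<close>

definition interp :: "nat \<Rightarrow> nat \<Rightarrow> complex^'n^'n \<Rightarrow> 'n::finite bmat" where
  "interp k Nc \<Phi> = (\<lambda>i J.
     if J < Nc \<and> i \<in> F_points k Nc
       then - bmult (F_points k Nc) (MF_inv k Nc \<Phi>) (system_mat k Nc \<Phi>) i (J * k)
     else if J < Nc \<and> i = J * k then mat 1
     else 0)"

definition inject :: "nat \<Rightarrow> nat \<Rightarrow> 'n::finite bmat" where
  "inject k Nc = (\<lambda>J i. if J < Nc \<and> i = J * k then mat 1 else 0)"

definition coarse_mat :: "nat \<Rightarrow> complex^'n^'n \<Rightarrow> 'n::finite bmat" where
  "coarse_mat Nc \<Psi> = bidiag Nc \<Psi>"

definition Mcgc_inv ::
    "nat \<Rightarrow> nat \<Rightarrow> complex^'n^'n \<Rightarrow> complex^'n^'n \<Rightarrow> 'n::finite bmat" where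
  "Mcgc_inv k Nc \<Phi> \<Psi> =
     bmult {..<Nc} (bmult {..<Nc} (interp k Nc \<Phi>) (binv {..<Nc} (coarse_mat Nc \<Psi>))) (inject k Nc)"

text \<open>\<open>propagator M_inv\<close> is \<open>I - M_inv A\<close>, the error propagation of one residual correction.\<close>

definition propagator :: "nat \<Rightarrow> nat \<Rightarrow> complex^'n^'n \<Rightarrow> 'n::finite bmat \<Rightarrow> 'n bmat" where
  "propagator k Nc \<Phi> M_inv = bminus bid (bmult {..<num_times k Nc} M_inv (system_mat k Nc \<Phi>))"

definition E_F :: "nat \<Rightarrow> nat \<Rightarrow> complex^'n^'n \<Rightarrow> complex^'n^'n \<Rightarrow> 'n::finite bmat" where
  "E_F k Nc \<Phi> \<Psi> =
     bmult {..<num_times k Nc}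
       (propagator k Nc \<Phi> (Mcgc_inv k Nc \<Phi> \<Psi>)) (propagator k Nc \<Phi> (MF_inv k Nc \<Phi>))"

definition E_FCF :: "nat \<Rightarrow> nat \<Rightarrow> complex^'n^'n \<Rightarrow> complex^'n^'n \<Rightarrow> 'n::finite bmat" where
  "E_FCF k Nc \<Phi> \<Psi> =
     bmult {..<num_times k Nc}
       (bmult {..<num_times k Nc} (E_F k Nc \<Phi> \<Psi>) (propagator k Nc \<Phi> (MC_inv k Nc \<Phi>)))
       (propagator k Nc \<Phi> (MF_inv k Nc \<Phi>))"

definition err_F ::
    "nat \<Rightarrow> nat \<Rightarrow> complex^'n^'n \<Rightarrow> complex^'n^'n \<Rightarrow> 'n::finite bvec \<Rightarrow> nat \<Rightarrow> 'n bvec" where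
  "err_F k Nc \<Phi> \<Psi> e0 i = (bapply (num_times k Nc) (E_F k Nc \<Phi> \<Psi>) ^^ i) e0"

definition err_FCF ::
    "nat \<Rightarrow> nat \<Rightarrow> complex^'n^'n \<Rightarrow> complex^'n^'n \<Rightarrow> 'n::finite bvec \<Rightarrow> nat \<Rightarrow> 'n bvec" where
  "err_FCF k Nc \<Phi> \<Psi> e0 i = (bapply (num_times k Nc) (E_FCF k Nc \<Phi> \<Psi>) ^^ i) e0"

definition res_F ::
    "nat \<Rightarrow> nat \<Rightarrow> complex^'n^'n \<Rightarrow> complex^'n^'n \<Rightarrow> 'n::finite bvec \<Rightarrow> nat \<Rightarrow> 'n bvec" where
  "res_F k Nc \<Phi> \<Psi> e0 i = bapply (num_times k Nc) (system_mat k Nc \<Phi>) (err_F k Nc \<Phi> \<Psi> e0 i)"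

definition res_FCF ::
    "nat \<Rightarrow> nat \<Rightarrow> complex^'n^'n \<Rightarrow> complex^'n^'n \<Rightarrow> 'n::finite bvec \<Rightarrow> nat \<Rightarrow> 'n bvec" where
  "res_FCF k Nc \<Phi> \<Psi> e0 i = bapply (num_times k Nc) (system_mat k Nc \<Phi>) (err_FCF k Nc \<Phi> \<Psi> e0 i)"

definition norm_AA :: "nat \<Rightarrow> nat \<Rightarrow> complex^'n^'n \<Rightarrow> 'n::finite bvec \<Rightarrow> real" where
  "norm_AA k Nc \<Phi> e =
     (let N = num_times k Nc; A = system_mat k Nc \<Phi>
      in sqrt (Re (binner N (bapply N (bmult {..<N} (badjoint A) A) e) e)))"

definition res_ratio_F ::
    "nat \<Rightarrow> nat \<Rightarrow> complex^'n^'n \<Rightarrow> complex^'n^'n \<Rightarrow> nat \<Rightarrow> 'n::finite bvec \<Rightarrow> real" where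
  "res_ratio_F k Nc \<Phi> \<Psi> i e0 =
     bnorm (num_times k Nc) (res_F k Nc \<Phi> \<Psi> e0 (i + 1))
       / bnorm (num_times k Nc) (res_F k Nc \<Phi> \<Psi> e0 i)"

definition err_ratio_F ::
    "nat \<Rightarrow> nat \<Rightarrow> complex^'n^'n \<Rightarrow> complex^'n^'n \<Rightarrow> nat \<Rightarrow> 'n::finite bvec \<Rightarrow> real" where
  "err_ratio_F k Nc \<Phi> \<Psi> i e0 =
     norm_AA k Nc \<Phi> (err_F k Nc \<Phi> \<Psi> e0 (i + 1)) / norm_AA k Nc \<Phi> (err_F k Nc \<Phi> \<Psi> e0 i)"

definition res_ratio_FCF ::
    "nat \<Rightarrow> nat \<Rightarrow> complex^'n^'n \<Rightarrow> complex^'n^'n \<Rightarrow> nat \<Rightarrow> 'n::finite bvec \<Rightarrow> real" where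
  "res_ratio_FCF k Nc \<Phi> \<Psi> i e0 =
     bnorm (num_times k Nc) (res_FCF k Nc \<Phi> \<Psi> e0 (i + 1))
       / bnorm (num_times k Nc) (res_FCF k Nc \<Phi> \<Psi> e0 i)"

definition err_ratio_FCF ::
    "nat \<Rightarrow> nat \<Rightarrow> complex^'n^'n \<Rightarrow> complex^'n^'n \<Rightarrow> nat \<Rightarrow> 'n::finite bvec \<Rightarrow> real" where
  "err_ratio_FCF k Nc \<Phi> \<Psi> i e0 =
     norm_AA k Nc \<Phi> (err_FCF k Nc \<Phi> \<Psi> e0 (i + 1)) / norm_AA k Nc \<Phi> (err_FCF k Nc \<Phi> \<Psi> e0 i)"

text \<open>Initial errors for which the residual after \<open>i\<close> iterations is nonzero.\<close>

definition starts_F ::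
    "nat \<Rightarrow> nat \<Rightarrow> complex^'n^'n \<Rightarrow> complex^'n^'n \<Rightarrow> nat \<Rightarrow> 'n::finite bvec set" where
  "starts_F k Nc \<Phi> \<Psi> i = {e0 \<in> block_vecs (num_times k Nc). res_F k Nc \<Phi> \<Psi> e0 i \<noteq> bzero}"

definition starts_FCF ::
    "nat \<Rightarrow> nat \<Rightarrow> complex^'n^'n \<Rightarrow> complex^'n^'n \<Rightarrow> nat \<Rightarrow> 'n::finite bvec set" where
  "starts_FCF k Nc \<Phi> \<Psi> i = {e0 \<in> block_vecs (num_times k Nc). res_FCF k Nc \<Phi> \<Psi> e0 i \<noteq> bzero}"

definition inv_sqrt_order :: "(nat \<Rightarrow> real) \<Rightarrow> bool" where
  "inv_sqrt_order \<epsilon> \<longleftrightarrow> (\<forall>n. 0 \<le> \<epsilon> n) \<and> \<epsilon> \<in> O(\<lambda>n. 1 / sqrt (real n))"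

end

theory Submission
  imports Defs
begin

text \<open>
  After one iteration the residual lives on the C-points, where further iterations act by the lower
  triangular block Toeplitz operator \<open>T = - D L B\<close>-inverse \<open>H L\<^sup>s\<close>; here \<open>L\<close> is the shift, \<open>D = \<Psi> - \<Phi>\<^sup>k\<close>, \<open>B\<close> is the
  coarse time-stepping matrix, and \<open>(s, H)\<close> is \<open>(0, I)\<close> for F- and \<open>(1, \<Phi>\<^sup>k)\<close> for FCF-relaxation. The
  TAP says that the symbol of \<open>T\<close> is bounded by \<open>\<phi>\<close>, so the Parseval identity bounds \<open>T\<close> by \<open>\<phi>\<close>. Since
  \<open>\<Psi>\<close> is invertible, the factor \<open>1 + \<parallel>\<Psi>\<^sup>N\<parallel>\<close> exceeds one and makes the bound strict. Conversely, a
  right-hand side whose coarse solution is a wave \<open>e\<^sup>-\<^sup>i\<^sup>x\<^sup>J v\<close> shows that a bound \<open>c\<close> for the truncated \<open>T\<^sup>p\<close> gives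
  a TAP with constant \<open>c (1 + O(1/N))\<close>: the first \<open>p\<close> entries, where it is not a wave, have size
  \<open>O(\<parallel>v\<parallel>)\<close>, and \<open>v\<close> is controlled by the symbol because \<open>I - e\<^sup>i\<^sup>x \<Psi>\<close> is uniformly invertible. If \<open>D\<close> is
  invertible, \<open>i\<close> iterations reach every residual that vanishes on the first \<open>(1 + s) i\<close> C-points,
  so the next iteration acts as \<open>T\<close> does on a coarse grid shortened by a fixed number of points.
\<close>

subsection \<open>Matrix powers and norms\<close>

lemma matpow_0 [simp]: "matpow M 0 = mat 1"
  and matpow_Suc [simp]: "matpow M (Suc m) = M ** matpow M m"
  by (simp_all add: matpow_def)

lemma matpow_add: "matpow M (a + b) = matpow M a ** matpow M b"
  by (induction a) (simp_all add: matrix_mul_assoc)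

lemma matpow_Suc_right: "matpow M (Suc m) = matpow M m ** M"
  using matpow_add[of M m 1] by simp

lemma matpow_commute:
  assumes "A ** B = B ** A"
  shows "matpow A m ** B = B ** matpow A m"
  by (induction m) (simp_all add: assms matrix_mul_assoc, metis assms matrix_mul_assoc)

lemma matpow_left_inverse:
  assumes "A ** B = mat 1"
  shows "matpow A m ** matpow B m = mat 1"
proof (induction m)
  case (Suc m)
  have "matpow A (Suc m) ** matpow B (Suc m) = matpow A m ** (A ** B) ** matpow B m"
    unfolding matpow_Suc_right[of A] by (simp add: matrix_mul_assoc)
  then show ?case using Suc assms by simp
qed simp

lemma matpow_mult_vec: "matpow M (a * m) *v x = (((*v) (matpow M a)) ^^ m) x"
  by (induction m) (simp_all add: matpow_add flip: matrix_vector_mul_assoc)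

lemma inverse_commute:
  assumes "A ** B = mat 1" "B ** A = mat 1" "A ** C = C ** A"
  shows "B ** C = C ** B"
proof -
  have "B ** C = B ** C ** (A ** B)" by (simp add: assms)
  also have "\<dots> = B ** (A ** C) ** B" by (simp add: matrix_mul_assoc assms(3))
  also have "\<dots> = (B ** A) ** C ** B" by (simp add: matrix_mul_assoc)
  finally show ?thesis by (simp add: assms)
qed

lemma matrix_inv_mult:
  assumes "invertible A"
  shows "A ** matrix_inv A = mat 1" and "matrix_inv A ** A = mat 1"
  using assms someI_ex[of "\<lambda>B. A ** B = mat 1 \<and> B ** A = mat 1"]
  by (auto simp: invertible_def matrix_inv_def)

lemma norm_smult_vec: "norm (c *s (v :: complex^'n)) = cmod c * norm v"
  by (simp add: norm_vec_def norm_mult L2_set_right_distrib[symmetric])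

lemma mat_mult_vec: "mat c *v v = c *s (v :: complex^'n)"
proof -
  have "(\<Sum>j\<in>UNIV. (if i = j then c else 0) * v $ j) = c * v $ i" for i
    by (simp add: if_distrib[of "\<lambda>x. x * _"] cong: if_cong)
  then show ?thesis
    by (simp add: vec_eq_iff matrix_vector_mult_def mat_def)
qed

lemma smult_smult_vec: "a *s (b *s v) = (a * b) *s (v :: complex^'n)"
  by (simp add: vec_eq_iff)

lemma mult_vec_uminus_right: "M *v (- v) = - (M *v (v :: complex^'n))"
  using matrix_vector_mult_diff_distrib[of M 0 v] by simp

lemma mult_vec_uminus_left: "(- M) *v v = - (M *v (v :: complex^'n))"
  using matrix_vector_mult_diff_rdistrib[of 0 M v] by simp

lemma mult_vec_scaleR: "M *v (r *\<^sub>R v) = r *\<^sub>R (M *v (v :: complex^'n))"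
  by (rule linear_scale) simp

lemma mult_vec_sum: "M *v (\<Sum>i\<in>S. f i) = (\<Sum>i\<in>S. M *v (f i :: complex^'n))"
  by (induction S rule: infinite_finite_induct) (simp_all add: matrix_vector_right_distrib)

lemma sum_mult_vec: "(\<Sum>i\<in>S. F i) *v v = (\<Sum>i\<in>S. F i *v (v :: complex^'n))"
  by (induction S rule: infinite_finite_induct) (simp_all add: matrix_vector_mult_add_rdistrib)

lemma opnorm: "norm (M *v v) \<le> opnorm M * norm v"
  unfolding opnorm_def by (rule onorm) simp

lemma opnorm_nonneg: "0 \<le> opnorm M"
  unfolding opnorm_def by (rule onorm_pos_le) simp

text \<open>A left inverse prevents \<open>M\<close> from annihilating a unit vector. Positivity of
  these norms is the source of strictness in the sufficient conditions.\<close>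

lemma opnorm_pos:
  assumes "A ** M = mat 1"
  shows "0 < opnorm (M :: complex^'n^'n)"
proof -
  have "M *v axis undefined 1 \<noteq> 0"
  proof
    assume "M *v axis undefined 1 = 0"
    then have "A *v (M *v axis undefined 1) = 0" by simp
    then show False by (simp add: matrix_vector_mul_assoc assms)
  qed
  then show ?thesis
    unfolding opnorm_def by (subst onorm_pos_lt) auto
qed

lemma bnorm_sq: "(bnorm n v)\<^sup>2 = (\<Sum>j<n. (norm (v j))\<^sup>2)"
  by (simp add: bnorm_def L2_set_def sum_nonneg)

lemma bnorm_nonneg: "0 \<le> bnorm n v"
  by (simp add: bnorm_def)

lemma bnorm_cong: "(\<And>j. j < n \<Longrightarrow> u j = v j) \<Longrightarrow> bnorm n u = bnorm n v"
  by (simp add: bnorm_def L2_set_def)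

lemma norm_vec_sq: "(norm (v :: complex^'n))\<^sup>2 = (\<Sum>a\<in>UNIV. (cmod (v $ a))\<^sup>2)"
  by (simp add: norm_vec_def L2_set_def sum_nonneg)

subsection \<open>Discrete Fourier transform\<close>

definition root_unity :: "nat \<Rightarrow> nat \<Rightarrow> complex" where
  "root_unity n m = cis (2 * pi * real m / real n)"

lemma root_unity_power: "root_unity n m ^ j = root_unity n j ^ m"
  by (simp add: root_unity_def Complex.DeMoivre mult_ac)

lemma norm_root_unity [simp]: "cmod (root_unity n m) = 1"
  by (simp add: root_unity_def)

text \<open>For distinct \<open>j\<close> and \<open>l\<close> below \<open>n\<close> the quotient
  \<open>a\<close> of two different \<open>n\<close>-th roots of unity is a root of unity other than
  one, so its geometric sum vanishes.\<close>

lemma root_unity_orthogonal: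
  assumes "j < n" "l < n"
  shows "(\<Sum>m<n. root_unity n m ^ j * cnj (root_unity n m ^ l)) = (if j = l then of_nat n else 0)"
proof -
  define a where "a = root_unity n j * cnj (root_unity n l)"
  have n: "n > 0" using assms by simp
  have cnj1: "root_unity n l * cnj (root_unity n l) = 1" for l
    by (simp add: complex_norm_square[symmetric])
  have "(\<Sum>m<n. root_unity n m ^ j * cnj (root_unity n m ^ l)) = (\<Sum>m<n. a ^ m)"
    by (simp add: a_def power_mult_distrib root_unity_power[of n _ j] root_unity_power[of n _ l])
  also have "\<dots> = (if j = l then of_nat n else 0)"
  proof (cases "j = l")
    case True
    then show ?thesis by (simp add: a_def cnj1)
  next
    case False
    have bij: "bij_betw (root_unity n) {..<n} {z. z ^ n = 1}"
      using Complex.bij_betw_roots_unity[OF n] by (simp add: root_unity_def[abs_def])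
    have "a \<noteq> 1"
    proof
      assume "a = 1"
      then have "root_unity n l = root_unity n l * cnj (root_unity n l) * root_unity n j"
        unfolding a_def by (simp add: mult_ac)
      then have "root_unity n l = root_unity n j" by (simp add: cnj1)
      then show False
        using bij assms False by (auto simp: bij_betw_def dest: inj_onD)
    qed
    moreover have "root_unity n j ^ n = 1" "root_unity n l ^ n = 1"
      using bij assms by (auto simp: bij_betw_def)
    then have "a ^ n = 1"
      by (simp add: a_def power_mult_distrib flip: complex_cnj_power)
    ultimately show ?thesis
      using False by (simp add: geometric_sum)
  qed
  finally show ?thesis .
qed

lemma parseval_scalar:
  fixes f :: "nat \<Rightarrow> complex"
  shows "(\<Sum>m<n. (cmod (\<Sum>j<n. root_unity n m ^ j * f j))\<^sup>2) = real n * (\<Sum>j<n. (cmod (f j))\<^sup>2)"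
proof -
  have "complex_of_real (\<Sum>m<n. (cmod (\<Sum>j<n. root_unity n m ^ j * f j))\<^sup>2)
      = (\<Sum>m<n. \<Sum>j<n. \<Sum>l<n. f j * cnj (f l) * (root_unity n m ^ j * cnj (root_unity n m ^ l)))"
    by (simp add: complex_norm_square sum_product mult_ac del: of_real_power)
  also have "\<dots> = (\<Sum>j<n. \<Sum>m<n. \<Sum>l<n. f j * cnj (f l) * (root_unity n m ^ j * cnj (root_unity n m ^ l)))"
    by (rule sum.swap)
  also have "\<dots> = (\<Sum>j<n. \<Sum>l<n. \<Sum>m<n. f j * cnj (f l) * (root_unity n m ^ j * cnj (root_unity n m ^ l)))"
    by (intro sum.cong refl sum.swap)
  also have "\<dots> = (\<Sum>j<n. \<Sum>l<n. f j * cnj (f l) * (if j = l then of_nat n else 0))"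
    by (intro sum.cong refl) (simp add: sum_distrib_left[symmetric] root_unity_orthogonal del: complex_cnj_power)
  also have "\<dots> = (\<Sum>j<n. f j * cnj (f j) * of_nat n)"
    by (intro sum.cong refl) (simp add: if_distrib[of "\<lambda>x. _ * x"] cong: if_cong)
  also have "\<dots> = complex_of_real (real n * (\<Sum>j<n. (cmod (f j))\<^sup>2))"
    by (simp add: complex_norm_square sum_distrib_left mult_ac del: of_real_power)
  finally show ?thesis using of_real_eq_iff by blast
qed

lemma parseval:
  fixes f :: "nat \<Rightarrow> complex^'n"
  shows "(\<Sum>m<n. (norm (\<Sum>j<n. root_unity n m ^ j *s f j))\<^sup>2) = real n * (\<Sum>j<n. (norm (f j))\<^sup>2)"
proof -
  have "(\<Sum>m<n. (norm (\<Sum>j<n. root_unity n m ^ j *s f j))\<^sup>2)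
     = (\<Sum>a\<in>UNIV. \<Sum>m<n. (cmod (\<Sum>j<n. root_unity n m ^ j * f j $ a))\<^sup>2)"
    by (subst sum.swap) (simp add: norm_vec_sq)
  also have "\<dots> = real n * (\<Sum>a\<in>UNIV. \<Sum>j<n. (cmod (f j $ a))\<^sup>2)"
    by (simp add: parseval_scalar sum_distrib_left)
  also have "\<dots> = real n * (\<Sum>j<n. (norm (f j))\<^sup>2)"
    by (subst sum.swap) (simp add: norm_vec_sq)
  finally show ?thesis .
qed

subsection \<open>The residual map on the coarse grid\<close>

definition shift :: "nat \<Rightarrow> 'n::finite bvec \<Rightarrow> 'n bvec" where
  "shift a f J = (if J < a then 0 else f (J - a))"

text \<open>Forward substitution for the coarse matrix: the solution \<open>z\<close> of
  \<open>(I - \<Psi> L) z = f\<close> on infinite sequences, \<open>L\<close> being the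
  shift.\<close>

fun solve :: "complex^'n^'n \<Rightarrow> 'n::finite bvec \<Rightarrow> 'n bvec" where
  "solve \<Psi> f 0 = f 0"
| "solve \<Psi> f (Suc J) = \<Psi> *v solve \<Psi> f J + f (Suc J)"

lemma shift_0 [simp]: "shift 0 f = f"
  by (simp add: shift_def fun_eq_iff)

lemma shift_shift: "shift a (shift b f) = shift (a + b) f"
  by (auto simp: shift_def fun_eq_iff)

lemma shift_Suc_Suc [simp]: "shift (Suc a) f (Suc J) = shift a f J"
  and shift_Suc_0 [simp]: "shift (Suc a) f 0 = 0"
  by (simp_all add: shift_def)

lemma solve_unique:
  assumes "\<And>J. g J = f J - \<Psi> *v shift 1 f J"
  shows "solve \<Psi> g J = f J"
  by (induction J) (simp_all add: assms)

lemma solve_residual [simplified]: "solve \<Psi> f J - \<Psi> *v shift 1 (solve \<Psi> f) J = f J"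
  by (cases J) simp_all

text \<open>The coefficients do not depend on time and the data before index 0 are zero, so delaying
  the source delays the solution.\<close>

lemma solve_shift: "solve \<Psi> (shift a f) = shift a (solve \<Psi> f)"
proof
  fix J
  show "solve \<Psi> (shift a f) J = shift a (solve \<Psi> f) J"
  proof (rule solve_unique)
    fix J
    have "shift a f J = (if J < a then 0 else solve \<Psi> f (J - a) - \<Psi> *v shift 1 (solve \<Psi> f) (J - a))"
      by (simp add: shift_def[of a] solve_residual)
    then show "shift a f J = shift a (solve \<Psi> f) J - \<Psi> *v shift 1 (shift a (solve \<Psi> f)) J"
      by (auto simp: shift_def)
  qed
qed

lemma solve_cong: "(\<And>I. I \<le> J \<Longrightarrow> f I = g I) \<Longrightarrow> solve \<Psi> f J = solve \<Psi> g J"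
  by (induction J) simp_all

lemma solve_free:
  assumes "\<And>j. j > n \<Longrightarrow> f j = 0"
  shows "solve \<Psi> f (n + j) = matpow \<Psi> j *v solve \<Psi> f n"
  by (induction j) (simp_all add: assms matrix_vector_mul_assoc)

lemma sum_shift:
  fixes f :: "'n::finite bvec"
  shows "(\<Sum>J<n. (norm (shift a f J))\<^sup>2) = (\<Sum>J<n - a. (norm (f J))\<^sup>2)"
proof (cases "a \<le> n")
  case True
  have "(\<Sum>J<n. (norm (shift a f J))\<^sup>2) = (\<Sum>J\<in>{a..<n}. (norm (f (J - a)))\<^sup>2)"
    by (rule sum.mono_neutral_cong_right) (auto simp: shift_def)
  also have "\<dots> = (\<Sum>J<n - a. (norm (f J))\<^sup>2)"
    by (rule sum.reindex_bij_witness[of _ "\<lambda>J. J + a" "\<lambda>J. J - a"]) auto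
  finally show ?thesis .
next
  case False
  then show ?thesis by (simp add: shift_def)
qed

text \<open>
  F-relaxation is the case \<open>G = H = I\<close>, \<open>s = 0\<close>; FCF-relaxation is the case \<open>H = \<Phi>\<^sup>k\<close>, \<open>G = H\<close>-inverse,
  \<open>s = 1\<close>. In both, \<open>D = \<Psi> - \<Phi>\<^sup>k\<close>. Sequences are infinite: all maps are causal, so truncation to \<open>Nc\<close>
  coarse points can wait until norms are taken.
\<close>

locale residual_map =
  fixes \<Psi> D G H :: "complex^'n^'n" and s q :: nat
  assumes GH: "G ** H = mat 1" and HG: "H ** G = mat 1"
    and contraction: "opnorm (matpow \<Psi> q) < 1"
begin

definition T :: "'n bvec \<Rightarrow> 'n bvec" where
  "T f = shift 1 (\<lambda>J. - (D *v solve \<Psi> (\<lambda>I. H *v shift s f I) J))"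

text \<open>The block Toeplitz operator \<open>G (I - \<Psi> L)\<close>; replacing the shift
  \<open>L\<close> by e^(ix) turns it into its symbol.\<close>

definition Q :: "'n bvec \<Rightarrow> 'n bvec" where
  "Q f = (\<lambda>J. G *v (f J - \<Psi> *v shift 1 f J))"

section \<open>The symbol and the temporal approximation property\<close>

definition symb :: "real \<Rightarrow> complex^'n^'n" where
  "symb x = G ** (mat 1 - mat (exp (\<i> * of_real x)) ** \<Psi>)"

text \<open>The F-TAP is the case in which \<open>G\<close> is the identity; the FCF-TAP is the case
  in which \<open>G\<close> is the inverse of \<Phi> to the power k.\<close>

definition TAP :: "nat \<Rightarrow> real \<Rightarrow> bool" where
  "TAP p c \<longleftrightarrow> (\<forall>v. norm (matpow D p *v v) \<le> c * (INF x\<in>{0..2*pi}. norm (matpow (symb x) p *v v)))"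

lemma G_H: "G *v (H *v v) = v" and H_G: "H *v (G *v v) = v"
  by (simp_all add: matrix_vector_mul_assoc GH HG)

lemma symb_vec: "symb x *v v = G *v (v - exp (\<i> * of_real x) *s (\<Psi> *v v))"
  by (simp add: symb_def matrix_vector_mul_assoc[symmetric] matrix_vector_mult_diff_rdistrib mat_mult_vec)

text \<open>A bound, uniform in \<open>x\<close>, for the norm of the inverse of
  \<open>symb x\<close>: the Neumann series of \<open>I - e^(ix) \<Psi>\<close> is grouped into
  blocks of \<open>q\<close> terms, and \<open>H\<close> undoes \<open>G\<close>.\<close>

definition symb_const :: real where
  "symb_const = (\<Sum>i<q. opnorm (matpow \<Psi> i)) / (1 - opnorm (matpow \<Psi> q)) * opnorm H"

lemma symb_const_nonneg: "0 \<le> symb_const"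
  using contraction by (auto simp: symb_const_def opnorm_nonneg sum_nonneg)

text \<open>Iterate \<open>v = u + e\<^sup>i\<^sup>x \<Psi> v\<close> up to the power \<open>q\<close> at which \<open>\<Psi>\<close> contracts.\<close>

lemma symb_lower: "norm v \<le> symb_const * norm (symb x *v v)"
proof -
  define u where "u = v - exp (\<i> * of_real x) *s (\<Psi> *v v)"
  have sum: "norm v \<le> (\<Sum>i<j. opnorm (matpow \<Psi> i)) * norm u + norm (matpow \<Psi> j *v v)" for j
  proof (induction j)
    case (Suc j)
    have "matpow \<Psi> j *v v = matpow \<Psi> j *v u + exp (\<i> * of_real x) *s (matpow \<Psi> (Suc j) *v v)"
      by (simp add: u_def matrix_vector_mult_diff_distrib vector_scalar_commute
          matrix_vector_mul_assoc matpow_Suc_right del: matpow_Suc)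
    then have "norm (matpow \<Psi> j *v v) \<le> norm (matpow \<Psi> j *v u) + norm (matpow \<Psi> (Suc j) *v v)"
      by (metis norm_triangle_ineq norm_smult_vec norm_exp_i_times mult_1)
    also have "\<dots> \<le> opnorm (matpow \<Psi> j) * norm u + norm (matpow \<Psi> (Suc j) *v v)"
      using opnorm by simp
    finally show ?case using Suc by (simp add: algebra_simps)
  qed simp
  have "norm v \<le> (\<Sum>i<q. opnorm (matpow \<Psi> i)) * norm u + opnorm (matpow \<Psi> q) * norm v"
    using sum[of q] opnorm[of "matpow \<Psi> q" v] by linarith
  then have "norm v \<le> (\<Sum>i<q. opnorm (matpow \<Psi> i)) / (1 - opnorm (matpow \<Psi> q)) * norm u"
    using contraction by (simp add: field_simps)
  also have "norm u \<le> opnorm H * norm (symb x *v v)"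
    using opnorm[of H "symb x *v v"] by (simp add: symb_vec H_G u_def)
  then have "(\<Sum>i<q. opnorm (matpow \<Psi> i)) / (1 - opnorm (matpow \<Psi> q)) * norm u \<le> symb_const * norm (symb x *v v)"
    unfolding symb_const_def mult.assoc using contraction
    by (intro mult_left_mono) (auto simp: opnorm_nonneg sum_nonneg)
  finally show ?thesis .
qed

lemma symb_power_lower: "norm v \<le> symb_const ^ p * norm (matpow (symb x) p *v v)"
proof (induction p)
  case (Suc p)
  have "symb_const ^ p * norm (matpow (symb x) p *v v)
      \<le> symb_const ^ p * (symb_const * norm (symb x *v (matpow (symb x) p *v v)))"
    by (intro mult_left_mono symb_lower zero_le_power symb_const_nonneg)
  then show ?case using Suc by (simp add: matrix_vector_mul_assoc mult_ac)
qed simp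

lemma TAP_I:
  assumes "c \<ge> 0" and "\<And>x v. norm (matpow D p *v v) \<le> c * norm (matpow (symb x) p *v v)"
  shows "TAP p c"
  unfolding TAP_def
proof
  fix v
  show "norm (matpow D p *v v) \<le> c * (INF x\<in>{0..2*pi}. norm (matpow (symb x) p *v v))"
  \<comment> \<open>Dividing by \<open>c\<close> turns the claim into a lower bound for an infimum;
    for \<open>c = 0\<close> the left-hand side is already zero.\<close>
  proof (cases "c = 0")
    case True
    then show ?thesis using assms(2)[of v 0] by simp
  next
    case False
    then have "norm (matpow D p *v v) / c \<le> (INF x\<in>{0..2*pi}. norm (matpow (symb x) p *v v))"
      using assms by (intro cINF_greatest) (auto simp: field_simps)
    then show ?thesis using False \<open>c \<ge> 0\<close> by (simp add: field_simps)
  qed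
qed

text \<open>Some constant always works because the symbol is uniformly invertible. It serves as a
  default on short coarse grids and for zero residuals.\<close>

lemma TAP_ex: "\<exists>c\<ge>0. TAP p c"
proof -
  define c where "c = opnorm (matpow D p) * symb_const ^ p"
  have c: "c \<ge> 0"
    unfolding c_def by (intro mult_nonneg_nonneg zero_le_power opnorm_nonneg symb_const_nonneg)
  have "TAP p c"
  proof (rule TAP_I[OF c])
    fix x v
    have "norm (matpow D p *v v) \<le> opnorm (matpow D p) * norm v"
      by (rule opnorm)
    also have "\<dots> \<le> opnorm (matpow D p) * (symb_const ^ p * norm (matpow (symb x) p *v v))"
      by (intro mult_left_mono symb_power_lower opnorm_nonneg)
    finally show "norm (matpow D p *v v) \<le> c * norm (matpow (symb x) p *v v)"
      by (simp add: c_def mult_ac)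
  qed
  with c show ?thesis by blast
qed

text \<open>For a unit vector the infimum is positive by \<open>symb_power_lower\<close>, so a
  negative \<open>c\<close> would make the right-hand side negative.\<close>

lemma TAP_nonneg:
  assumes "TAP p c"
  shows "c \<ge> 0"
proof (rule ccontr)
  assume "\<not> c \<ge> 0"
  define v :: "complex^'n" where "v = axis undefined 1"
  have v: "norm v > 0" by (simp add: v_def axis_eq_0_iff)
  have "symb_const ^ p \<noteq> 0"
    using symb_power_lower[of v p 0] v by (metis mult_zero_left not_less)
  then have K: "symb_const ^ p > 0"
    using zero_le_power[OF symb_const_nonneg, of p] by linarith
  have "norm v / symb_const ^ p \<le> (INF x\<in>{0..2*pi}. norm (matpow (symb x) p *v v))"
    using symb_power_lower[of v p] v K by (intro cINF_greatest) (auto simp: field_simps)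
  moreover have "norm v / symb_const ^ p > 0" using K v by simp
  ultimately have "(INF x\<in>{0..2*pi}. norm (matpow (symb x) p *v v)) > 0" by linarith
  then have "c * (INF x\<in>{0..2*pi}. norm (matpow (symb x) p *v v)) < 0"
    using \<open>\<not> c \<ge> 0\<close> by (simp add: mult_neg_pos)
  then show False using assms norm_ge_zero[of "matpow D p *v v"]
    unfolding TAP_def by (meson dual_order.trans leD)
qed

lemma TAP_D:
  assumes "TAP p c" "x \<in> {0..2*pi}"
  shows "norm (matpow D p *v v) \<le> c * norm (matpow (symb x) p *v v)"
proof -
  have "(INF x\<in>{0..2*pi}. norm (matpow (symb x) p *v v)) \<le> norm (matpow (symb x) p *v v)"
    using assms(2) by (intro cINF_lower bdd_belowI[of _ 0]) auto
  then show ?thesis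
    using assms(1) TAP_nonneg[OF assms(1)] unfolding TAP_def by (meson mult_left_mono order_trans)
qed


section \<open>Upper bound for \<open>T\<close> by Fourier analysis\<close>

text \<open>Since \<open>f\<close> vanishes at the last of the \<open>n + 1\<close> points, the discrete Fourier transform of that
  length sees no wrap-around and turns \<open>Q\<close> into multiplication by the symbol.\<close>

lemma fourier_bound:
  assumes tap: "TAP 1 c" and supp: "f n = 0"
  shows "(\<Sum>j<n. (norm (D *v f j))\<^sup>2) \<le> c\<^sup>2 * (\<Sum>j\<le>n. (norm (Q f j))\<^sup>2)"
proof -
  define N where "N = Suc n"
  define h where "h m = (\<Sum>j<N. root_unity N m ^ j *s f j)" for m
  have freq: "norm (D *v h m) \<le> c * norm (\<Sum>j<N. root_unity N m ^ j *s Q f j)" if "m < N" for m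
  proof -
    define x where "x = 2 * pi * real m / real N"
    define e where "e = root_unity N m"
    have x: "x \<in> {0..2*pi}"
      using that by (auto simp: x_def field_simps)
    have e: "exp (\<i> * of_real x) = e"
      by (simp add: e_def root_unity_def cis_conv_exp x_def)
    have "e *s (\<Psi> *v h m) = (\<Sum>j<N. e ^ Suc j *s (\<Psi> *v f j))"
      by (simp add: h_def mult_vec_sum vector_scalar_commute smult_smult_vec e_def
          vec.scale_sum_right)
    also have "\<dots> = (\<Sum>j<n. e ^ Suc j *s (\<Psi> *v shift 1 f (Suc j)))"
      by (simp add: N_def supp)
    also have "\<dots> = (\<Sum>j<N. e ^ j *s (\<Psi> *v shift 1 f j))"
      unfolding N_def by (subst sum.lessThan_Suc_shift) simp
    finally have "symb x *v h m = G *v (\<Sum>j<N. e ^ j *s (f j - \<Psi> *v shift 1 f j))"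
      by (simp add: symb_vec e h_def e_def[symmetric] sum_subtractf vector_ssub_ldistrib)
    also have "\<dots> = (\<Sum>j<N. e ^ j *s Q f j)"
      unfolding mult_vec_sum vector_scalar_commute Q_def ..
    finally show ?thesis
      using TAP_D[OF tap x, of "h m"] by (simp add: e_def)
  qed
  have "real N * (\<Sum>j<N. (norm (D *v f j))\<^sup>2) = (\<Sum>m<N. (norm (D *v h m))\<^sup>2)"
    by (simp add: parseval[symmetric] h_def mult_vec_sum vector_scalar_commute)
  also have "\<dots> \<le> (\<Sum>m<N. (c * norm (\<Sum>j<N. root_unity N m ^ j *s Q f j))\<^sup>2)"
    using freq by (intro sum_mono power_mono) auto
  also have "\<dots> = real N * (c\<^sup>2 * (\<Sum>j<N. (norm (Q f j))\<^sup>2))"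
    by (simp add: power_mult_distrib sum_distrib_left[symmetric] parseval)
  finally have "(\<Sum>j<N. (norm (D *v f j))\<^sup>2) \<le> c\<^sup>2 * (\<Sum>j<N. (norm (Q f j))\<^sup>2)"
    by (simp add: N_def)
  then show ?thesis
    unfolding lessThan_Suc_atMost[symmetric] by (simp add: N_def supp)
qed

text \<open>The outer \<open>shift 1\<close> makes \<open>T\<close> strictly causal, so a truncation
  of \<open>f\<close> at \<open>n\<close> leaves the first \<open>n\<close> entries of
  \<open>T f\<close> unchanged.\<close>

lemma T_cong: "(\<And>I. I < J \<Longrightarrow> f I = g I) \<Longrightarrow> T f J = T g J"
  unfolding T_def by (cases J) (auto intro!: arg_cong[of _ _ "\<lambda>v. D *v v"] solve_cong simp: shift_def)

text \<open>Cut off the coarse solution \<open>z\<close> at an index \<open>M\<close> beyond the support of the right-hand side; the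
  cut-off error decays geometrically in \<open>t\<close>.\<close>

lemma T_bound:
  assumes tap: "TAP 1 c"
  shows "bnorm n (T f) \<le> c * bnorm n f"
proof -
  have c: "c \<ge> 0" using TAP_nonneg tap .
  \<comment> \<open>Truncation gives the source finite support, so that \<open>z\<close> evolves
    freely from \<open>n + s\<close> on.\<close>
  define g where "g J = (if J < n then f J else 0)" for J
  define z where "z = solve \<Psi> (\<lambda>I. H *v shift s g I)"
  define b where "b = opnorm (matpow \<Psi> q)"
  define w where "w = norm (z (n + s))"
  define K where "K = opnorm G * opnorm \<Psi>"
  have b: "0 \<le> b" "b < 1" using contraction by (auto simp: b_def opnorm_nonneg)
  have "Q z J = shift s g J" for J
    by (simp add: Q_def z_def solve_residual G_H)
  then have Qz: "(\<Sum>j\<le>m. (norm (Q z j))\<^sup>2) \<le> (bnorm n f)\<^sup>2" for m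
  proof -
    have "(\<Sum>j\<le>m. (norm (Q z j))\<^sup>2) = (\<Sum>j<Suc m - s. (norm (g j))\<^sup>2)"
      using \<open>\<And>J. Q z J = shift s g J\<close> by (simp add: sum_shift lessThan_Suc_atMost[symmetric] del: sum.lessThan_Suc)
    also have "\<dots> \<le> (\<Sum>j<max n (Suc m - s). (norm (g j))\<^sup>2)"
      by (rule sum_mono2) auto
    also have "\<dots> = (bnorm n f)\<^sup>2"
      unfolding bnorm_sq by (rule sum.mono_neutral_cong_right) (auto simp: g_def)
    finally show ?thesis .
  qed
  have tail: "norm (z (n + s + q * t)) \<le> b ^ t * w" for t
  proof -
    have "z (n + s + q * t) = matpow \<Psi> (q * t) *v z (n + s)"
      unfolding z_def by (rule solve_free) (auto simp: shift_def g_def)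
    also have "norm \<dots> \<le> b ^ t * w"
    proof (induction t)
      case (Suc t)
      have "norm (matpow \<Psi> (q * Suc t) *v z (n + s)) \<le> b * norm (matpow \<Psi> (q * t) *v z (n + s))"
        unfolding matpow_mult_vec b_def by (simp add: opnorm)
      also have "\<dots> \<le> b * (b ^ t * w)" using Suc b by (intro mult_left_mono) auto
      finally show ?case by simp
    qed (simp add: w_def)
    finally show ?thesis .
  qed
  have main: "(bnorm n (T f))\<^sup>2 \<le> c\<^sup>2 * ((bnorm n f)\<^sup>2 + (K * (b ^ t * w))\<^sup>2)" for t
  proof -
    define M where "M = n + s + q * t"
    define h where "h J = (if J \<le> M then z J else 0)" for J
    have Qh: "Q h j = Q z j" if "j \<le> M" for j
      using that by (auto simp: Q_def h_def shift_def)
    \<comment> \<open>The cut-off produces a single spurious entry, \<open>- G \<Psi> z M\<close> at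
      index \<open>Suc M\<close>.\<close>
    have "norm (Q h (Suc M)) \<le> opnorm G * (opnorm \<Psi> * norm (z M))"
      by (auto simp: Q_def h_def mult_vec_uminus_right
          intro!: order_trans[OF opnorm] mult_left_mono opnorm_nonneg opnorm)
    also have "\<dots> \<le> K * (b ^ t * w)"
      unfolding K_def mult.assoc using tail[of t]
      by (intro mult_left_mono opnorm_nonneg) (simp add: M_def)
    finally have "norm (Q h (Suc M)) \<le> K * (b ^ t * w)" .
    then have last: "(norm (Q h (Suc M)))\<^sup>2 \<le> (K * (b ^ t * w))\<^sup>2"
      by (intro power_mono) auto
    have "(bnorm n (T f))\<^sup>2 = (bnorm n (T g))\<^sup>2"
      by (intro arg_cong[of _ _ "\<lambda>x. x\<^sup>2"] bnorm_cong T_cong) (auto simp: g_def)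
    also have "\<dots> = (\<Sum>j<n - 1. (norm (D *v z j))\<^sup>2)"
      by (simp add: bnorm_sq T_def sum_shift z_def)
    also have "\<dots> = (\<Sum>j<n - 1. (norm (D *v h j))\<^sup>2)"
      by (rule sum.cong) (auto simp: h_def M_def)
    also have "\<dots> \<le> (\<Sum>j<Suc M. (norm (D *v h j))\<^sup>2)"
      by (rule sum_mono2) (auto simp: M_def)
    also have "\<dots> \<le> c\<^sup>2 * (\<Sum>j\<le>Suc M. (norm (Q h j))\<^sup>2)"
      by (rule fourier_bound[OF tap]) (simp add: h_def)
    also have "\<dots> \<le> c\<^sup>2 * ((bnorm n f)\<^sup>2 + (K * (b ^ t * w))\<^sup>2)"
      using last Qz[of M] by (intro mult_left_mono) (auto simp: Qh)
    finally show ?thesis .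
  qed
  \<comment> \<open>The bound \<open>main\<close> holds for every \<open>t\<close>, so the
    contribution of the cut-off disappears in the limit.\<close>
  have "(\<lambda>t. b ^ t) \<longlonglongrightarrow> 0"
    using b by (rule LIMSEQ_realpow_zero)
  moreover have "isCont (\<lambda>x. c\<^sup>2 * ((bnorm n f)\<^sup>2 + (K * (x * w))\<^sup>2)) 0"
    by (intro continuous_intros)
  ultimately have "(\<lambda>t. c\<^sup>2 * ((bnorm n f)\<^sup>2 + (K * (b ^ t * w))\<^sup>2)) \<longlonglongrightarrow> c\<^sup>2 * ((bnorm n f)\<^sup>2 + (K * (0 * w))\<^sup>2)"
    by (rule isCont_tendsto_compose[rotated])
  then have "(bnorm n (T f))\<^sup>2 \<le> c\<^sup>2 * ((bnorm n f)\<^sup>2 + (K * (0 * w))\<^sup>2)"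
    by (rule LIMSEQ_le_const) (use main in auto)
  then have "(bnorm n (T f))\<^sup>2 \<le> (c * bnorm n f)\<^sup>2"
    by (simp add: power_mult_distrib)
  then show ?thesis
    by (rule power2_le_imp_le) (simp add: c bnorm_nonneg)
qed

end

section \<open>Lower bound for the powers of \<open>T\<close>, and their range\<close>

context residual_map begin

lemma shift_swap: "shift 1 (\<lambda>J. - (D *v shift a z J)) = shift a (shift 1 (\<lambda>J. - (D *v z J)))"
  by (auto simp: shift_def fun_eq_iff diff_commute)

lemma T_shift: "T (shift a f) = shift a (T f)"
proof -
  have "(\<lambda>I. H *v shift s (shift a f) I) = shift a (\<lambda>I. H *v shift s f I)"
    by (auto simp: shift_def fun_eq_iff add.commute)
  then have "T (shift a f) = shift 1 (\<lambda>J. - (D *v shift a (solve \<Psi> (\<lambda>I. H *v shift s f I)) J))"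
    unfolding T_def by (simp only: solve_shift)
  also have "\<dots> = shift a (shift 1 (\<lambda>J. - (D *v solve \<Psi> (\<lambda>I. H *v shift s f I) J)))"
    by (rule shift_swap)
  finally show ?thesis unfolding T_def .
qed

lemma T_power_shift: "(T ^^ p) (shift a f) = shift a ((T ^^ p) f)"
  by (induction p) (simp_all add: T_shift)

text \<open>Up to a shift, \<open>Q\<close> inverts \<open>T\<close>: applying \<open>T\<close> after it leaves only \<open>- D\<close>.\<close>

definition U :: "'n bvec \<Rightarrow> 'n bvec" where
  "U f = shift (Suc s) (\<lambda>J. - (D *v f J))"

lemma T_Q: "T (Q f) = U f"
proof -
  have "solve \<Psi> (\<lambda>I. H *v shift s (Q f) I) J = shift s f J" for J
    by (rule solve_unique) (auto simp: shift_def Q_def H_G)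
  then have "T (Q f) = shift 1 (\<lambda>J. - (D *v shift s f J))"
    unfolding T_def by simp
  also have "\<dots> = U f"
    by (auto simp: U_def shift_def fun_eq_iff)
  finally show ?thesis .
qed

lemma U_Q:
  assumes "D ** \<Psi> = \<Psi> ** D" "D ** G = G ** D"
  shows "U (Q f) = Q (U f)"
proof -
  have "D *v (G *v v) = G *v (D *v v)" "D *v (\<Psi> *v v) = \<Psi> *v (D *v v)" for v
    by (simp_all add: matrix_vector_mul_assoc assms)
  then have "U (Q f) J = Q (U f) J" for J
    by (cases "J < Suc s"; cases "J = Suc s")
       (auto simp: U_def Q_def shift_def matrix_vector_mult_diff_distrib mult_vec_uminus_right diff_commute)
  then show ?thesis by blast
qed

text \<open>\<open>T\<close> cancels the outermost \<open>Q\<close> and leaves \<open>U\<close>,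
  which commutation moves past the remaining factors of \<open>Q\<close>. The case
  \<open>p = 1\<close> is a single cancellation; it serves the conditions on one iteration, where
  \<Phi> and \<Psi> are not assumed to commute.\<close>

lemma T_power_Q_power:
  assumes "p = 1 \<or> D ** \<Psi> = \<Psi> ** D \<and> D ** G = G ** D"
  shows "(T ^^ p) ((Q ^^ p) f) = (U ^^ p) f"
  using assms
proof
  assume c: "D ** \<Psi> = \<Psi> ** D \<and> D ** G = G ** D"
  have UQ: "U ((Q ^^ n) f) = (Q ^^ n) (U f)" for n f
    using c by (induction n) (simp_all add: U_Q)
  show ?thesis
  proof (induction p arbitrary: f)
    case (Suc p)
    have "(T ^^ Suc p) ((Q ^^ Suc p) f) = (T ^^ p) (T (Q ((Q ^^ p) f)))"
      by (simp only: funpow.simps o_apply funpow_swap1[of T])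
    also have "\<dots> = (U ^^ p) (U f)"
      by (simp only: T_Q UQ Suc)
    finally show ?case by (simp add: funpow_swap1)
  qed simp
qed (simp add: T_Q)

lemma U_power: "(U ^^ p) f = shift (Suc s * p) (\<lambda>J. (- 1) ^ p *\<^sub>R (matpow D p *v f J))"
proof (induction p)
  case (Suc p)
  have "(U ^^ Suc p) f = shift (Suc s) (\<lambda>J. - (D *v shift (Suc s * p) (\<lambda>J. (- 1) ^ p *\<^sub>R (matpow D p *v f J)) J))"
    by (simp add: Suc U_def[of "shift _ _"])
  also have "(\<lambda>J. - (D *v shift (Suc s * p) (\<lambda>J. (- 1) ^ p *\<^sub>R (matpow D p *v f J)) J))
      = shift (Suc s * p) (\<lambda>J. (- 1) ^ Suc p *\<^sub>R (matpow D (Suc p) *v f J))"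
    by (auto simp: shift_def fun_eq_iff mult_vec_scaleR matrix_vector_mul_assoc)
  finally show ?case by (simp add: shift_shift)
qed simp

definition wave :: "real \<Rightarrow> complex^'n \<Rightarrow> 'n bvec" where
  "wave x v = (\<lambda>J. exp (- (\<i> * of_real x)) ^ J *s v)"

lemma norm_wave: "norm (wave x v J) = norm v"
  by (simp add: wave_def norm_smult_vec norm_power exp_minus norm_inverse)

text \<open>Each \<open>Q\<close> looks back one entry, and the zero before index 0 breaks the wave
  there. Every application therefore spoils one more entry, whence \<open>p \<le> J\<close>.\<close>

lemma Q_power_wave:
  assumes "p \<le> J"
  shows "(Q ^^ p) (wave x v) J = wave x (matpow (symb x) p *v v) J"
  using assms
proof (induction p arbitrary: J)
  case (Suc p)
  then obtain I where J: "J = Suc I" "p \<le> I" by (cases J) auto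
  define u where "u = matpow (symb x) p *v v"
  have step: "wave x u I = exp (\<i> * of_real x) *s wave x u (Suc I)"
    by (simp add: wave_def smult_smult_vec exp_minus mult.assoc[symmetric])
  have "(Q ^^ Suc p) (wave x v) J = G *v (wave x u (Suc I) - \<Psi> *v wave x u I)"
    using Suc.IH[of J] Suc.IH[of I] J
    by (simp add: Q_def[of "(Q ^^ p) (wave x v)"] shift_def u_def)
  also have "\<dots> = symb x *v wave x u (Suc I)"
    by (simp add: symb_vec step vector_scalar_commute)
  also have "\<dots> = wave x (matpow (symb x) (Suc p) *v v) J"
    by (simp add: wave_def J u_def vector_scalar_commute matrix_vector_mul_assoc)
  finally show ?case .
qed simp

text \<open>A crude bound for the first \<open>p\<close> entries, where the result is not a
  wave.\<close>

lemma Q_power_bound: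
  assumes "\<And>J. norm (f J) \<le> b"
  shows "norm ((Q ^^ p) f J) \<le> (opnorm G * (1 + opnorm \<Psi>)) ^ p * b"
proof (induction p arbitrary: J)
  case (Suc p)
  define B where "B = (opnorm G * (1 + opnorm \<Psi>)) ^ p * b"
  have B: "norm (shift 1 ((Q ^^ p) f) J) \<le> B" "B \<ge> 0"
    using Suc[of "J - 1"] norm_ge_zero order_trans[OF norm_ge_zero Suc] by (auto simp: shift_def B_def)
  have "norm ((Q ^^ Suc p) f J) \<le> opnorm G * norm ((Q ^^ p) f J - \<Psi> *v shift 1 ((Q ^^ p) f) J)"
    by (simp add: Q_def opnorm)
  also have "\<dots> \<le> opnorm G * (B + opnorm \<Psi> * B)"
    using Suc[of J] B opnorm_nonneg[of \<Psi>]
    by (intro mult_left_mono opnorm_nonneg order_trans[OF norm_triangle_ineq4] add_mono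
        order_trans[OF opnorm]) (auto simp: B_def)
  finally show ?case by (simp add: B_def algebra_simps)
qed (use assms in simp)

text \<open>Test \<open>T\<close> on \<open>(Q ^^ p) (wave x v)\<close>, which is a wave again except for its first \<open>p\<close> entries.\<close>

lemma T_lower:
  assumes comm: "p = 1 \<or> D ** \<Psi> = \<Psi> ** D \<and> D ** G = G ** D"
  shows "\<exists>K\<ge>0. \<forall>n c. n > a + Suc s * p \<longrightarrow> 0 \<le> c \<longrightarrow>
           (\<forall>f. bnorm n ((T ^^ p) (shift a f)) \<le> c * bnorm n (shift a f)) \<longrightarrow>
           TAP p (c * (1 + K / real (n - (a + Suc s * p))))"
proof -
  define M where "M = (opnorm G * (1 + opnorm \<Psi>)) ^ p"
  \<comment> \<open>The first summand counts the entries of the test vector that the shifts in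
    \<open>U\<close> push beyond the grid; the second bounds the \<open>p\<close> spoiled entries,
    with the norm of \<open>v\<close> estimated through the symbol.\<close>
  define K where "K = real (Suc s * p) + real p * (M * symb_const ^ p)\<^sup>2"
  have K: "K \<ge> 0" by (simp add: K_def)
  have "TAP p (c * (1 + K / real (n - (a + Suc s * p))))"
    if n: "n > a + Suc s * p" and c: "0 \<le> c"
      and bound: "\<And>f. bnorm n ((T ^^ p) (shift a f)) \<le> c * bnorm n (shift a f)" for n c
  proof (rule TAP_I)
    define m where "m = n - (a + Suc s * p)"
    have m: "m > 0" "n - a = m + Suc s * p" using n by (auto simp: m_def)
    then show "0 \<le> c * (1 + K / real (n - (a + Suc s * p)))"
      using K c unfolding m_def[symmetric] by simp
    fix x v
    define u where "u = matpow (symb x) p *v v"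
    define f where "f = (Q ^^ p) (wave x v)"
    have "(T ^^ p) (shift a f) = shift (a + Suc s * p) (\<lambda>J. (- 1) ^ p *\<^sub>R (matpow D p *v wave x v J))"
      unfolding T_power_shift f_def T_power_Q_power[OF comm] U_power shift_shift ..
    then have "(bnorm n ((T ^^ p) (shift a f)))\<^sup>2 = real m * (norm (matpow D p *v v))\<^sup>2"
      by (simp add: bnorm_sq sum_shift m_def[symmetric] wave_def vector_scalar_commute
          norm_smult_vec norm_power exp_minus norm_inverse del: mult_Suc)
    moreover have "c\<^sup>2 * (bnorm n (shift a f))\<^sup>2 \<le> c\<^sup>2 * ((real m + K) * (norm u)\<^sup>2)"
    proof (rule mult_left_mono)
      show "(bnorm n (shift a f))\<^sup>2 \<le> (real m + K) * (norm u)\<^sup>2"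
      proof -
        have "(norm (f J))\<^sup>2 \<le> (norm u)\<^sup>2 + (if J < p then (M * symb_const ^ p)\<^sup>2 * (norm u)\<^sup>2 else 0)" for J
        proof (cases "J < p")
          case True
          have "M \<ge> 0" by (simp add: M_def opnorm_nonneg)
          have "norm (f J) \<le> M * norm v"
            unfolding f_def M_def by (rule Q_power_bound) (simp add: norm_wave)
          also have "\<dots> \<le> M * (symb_const ^ p * norm u)"
            unfolding u_def by (intro mult_left_mono symb_power_lower \<open>M \<ge> 0\<close>)
          finally have "(norm (f J))\<^sup>2 \<le> (M * symb_const ^ p * norm u)\<^sup>2"
            by (intro power_mono) (auto simp: mult_ac)
          then show ?thesis using True by (simp add: power_mult_distrib add_increasing)
        next
          case False
          then show ?thesis by (simp add: f_def Q_power_wave norm_wave u_def)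
        qed
        then have "(bnorm n (shift a f))\<^sup>2
            \<le> (\<Sum>J<n - a. (norm u)\<^sup>2 + (if J < p then (M * symb_const ^ p)\<^sup>2 * (norm u)\<^sup>2 else 0))"
          unfolding bnorm_sq sum_shift by (rule sum_mono)
        also have "\<dots> = real (n - a) * (norm u)\<^sup>2
            + (\<Sum>J<n - a. if J < p then (M * symb_const ^ p)\<^sup>2 * (norm u)\<^sup>2 else 0)"
          by (simp add: sum.distrib)
        also have "(\<Sum>J<n - a. if J < p then (M * symb_const ^ p)\<^sup>2 * (norm u)\<^sup>2 else 0)
            = (\<Sum>J<p. (M * symb_const ^ p)\<^sup>2 * (norm u)\<^sup>2)"
          using m by (intro sum.mono_neutral_cong_right) auto
        finally show ?thesis using m by (simp add: K_def algebra_simps)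
      qed
    qed simp
    moreover have "(bnorm n ((T ^^ p) (shift a f)))\<^sup>2 \<le> c\<^sup>2 * (bnorm n (shift a f))\<^sup>2"
      using bound[of f] bnorm_nonneg by (metis power_mono power_mult_distrib)
    ultimately have "real m * (norm (matpow D p *v v))\<^sup>2 \<le> c\<^sup>2 * ((real m + K) * (norm u)\<^sup>2)"
      by linarith
    then have "(norm (matpow D p *v v))\<^sup>2 \<le> (1 + K / real m) * (c * norm u)\<^sup>2"
      using m by (simp add: field_simps power2_eq_square)
    \<comment> \<open>The factor is at least one, so it may be squared; this avoids a square root in
      the final constant.\<close>
    also have "\<dots> \<le> (1 + K / real m)\<^sup>2 * (c * norm u)\<^sup>2"
      using K by (intro mult_right_mono) (auto intro!: self_le_power)
    finally have "(norm (matpow D p *v v))\<^sup>2 \<le> ((1 + K / real m) * (c * norm u))\<^sup>2"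
      by (simp add: power_mult_distrib)
    then have "norm (matpow D p *v v) \<le> (1 + K / real m) * (c * norm u)"
      by (rule power2_le_imp_le) (use K c in auto)
    then show "norm (matpow D p *v v) \<le> c * (1 + K / real (n - (a + Suc s * p))) * norm (matpow (symb x) p *v v)"
      by (simp add: m_def u_def mult_ac)
  qed
  then show ?thesis using K by blast
qed

text \<open>A preimage under \<open>T\<close> of a shifted \<open>g\<close> is \<open>Q\<close>
  applied to \<open>- D' g\<close>: \<open>T\<close> undoes \<open>Q\<close> and leaves
  \<open>- D\<close>, which cancels \<open>- D'\<close>. Each iteration costs \<open>Suc s\<close>
  leading entries.\<close>

lemma T_power_range:
  assumes "D ** D' = mat 1"
  shows "\<exists>g. (T ^^ i) g = shift (Suc s * i) f"
proof (induction i)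
  case (Suc i)
  then obtain g where g: "(T ^^ i) g = shift (Suc s * i) f" by blast
  have "T (Q (\<lambda>J. - (D' *v g J))) = shift (Suc s) g"
    unfolding T_Q U_def by (simp add: mult_vec_uminus_right matrix_vector_mul_assoc assms)
  then have "(T ^^ Suc i) (Q (\<lambda>J. - (D' *v g J))) = shift (Suc s * Suc i) f"
    by (simp add: funpow_swap1 T_power_shift g shift_shift)
  then show ?case by blast
qed (simp add: exI[of _ f])

end

subsection \<open>Block matrices\<close>

lemma bapply_cong: "(\<And>j. j < n \<Longrightarrow> u j = v j) \<Longrightarrow> bapply n X u = bapply n X v"
  by (simp add: bapply_def)

lemma bapply_minus: "bapply n X (\<lambda>j. u j - v j) i = bapply n X u i - bapply n X v i"
  by (simp add: bapply_def matrix_vector_mult_diff_distrib sum_subtractf)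

lemma bapply_bmult: "bapply n (bmult S X Y) v i = (\<Sum>l\<in>S. X i l *v bapply n Y v l)"
proof -
  have "bapply n (bmult S X Y) v i = (\<Sum>j<n. \<Sum>l\<in>S. X i l *v (Y l j *v v j))"
    by (simp add: bapply_def bmult_def sum_mult_vec matrix_vector_mul_assoc)
  also have "\<dots> = (\<Sum>l\<in>S. X i l *v bapply n Y v l)"
    by (subst sum.swap) (simp add: bapply_def mult_vec_sum)
  finally show ?thesis .
qed

lemma bapply_bmult_lessThan: "bapply n (bmult {..<n} X Y) v = bapply n X (bapply n Y v)"
  by (simp add: fun_eq_iff bapply_bmult bapply_def[of n X])

lemma bapply_bid: "bapply n bid v i = (if i < n then v i else 0)"
proof -
  have "bapply n bid v i = (\<Sum>j<n. if i = j then v j else 0)"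
    unfolding bapply_def by (rule sum.cong) (auto simp: bid_def)
  then show ?thesis by simp
qed

lemma bapply_bidiag:
  "bapply n (bidiag n M) v i = (if i < n then v i - M *v shift 1 v i else 0)"
proof (cases "i < n")
  case True
  have "bapply n (bidiag n M) v i = (\<Sum>j<n. (if j = i then v j else 0) - (if j = i - 1 then M *v shift 1 v i else 0))"
    unfolding bapply_def using True
    by (intro sum.cong) (auto simp: bidiag_def mult_vec_uminus_left shift_def)
  then show ?thesis using True by (simp add: sum_subtractf)
qed (simp add: bapply_def bidiag_def)

section \<open>Inverses of submatrices of bidiagonal block matrices\<close>

lemma matrix_mult_uminus:
  fixes A B :: "complex^'n^'n"
  shows "(- A) ** B = - (A ** B)" "A ** (- B) = - (A ** B)"
  by (simp_all add: vec_eq_iff matrix_matrix_mult_def sum_negf)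

text \<open>The subdiagonal term survives only if the predecessor lies in \<open>S\<close>; for the
  F-points this cuts the matrix at every C-point.\<close>

lemma sum_bidiag_left:
  fixes M :: "complex^'n^'n" and Z :: "nat \<Rightarrow> complex^'n^'n"
  assumes "finite S" "S \<subseteq> {..<n}" "i \<in> S"
  shows "(\<Sum>l\<in>S. bidiag n M i l ** Z l) = Z i - (if i > 0 \<and> i - 1 \<in> S then M ** Z (i - 1) else 0)"
proof -
  have "(\<Sum>l\<in>S. bidiag n M i l ** Z l)
      = (\<Sum>l\<in>S. (if l = i then Z l else 0) - (if l = i - 1 then if i > 0 then M ** Z (i - 1) else 0 else 0))"
    using assms by (intro sum.cong) (auto simp: bidiag_def matrix_mult_uminus)
  then show ?thesis using assms(1,3) by (auto simp: sum_subtractf)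
qed

lemma sum_bidiag_right:
  fixes M :: "complex^'n^'n" and Z :: "nat \<Rightarrow> complex^'n^'n"
  assumes "finite S" "S \<subseteq> {..<n}" "j \<in> S"
  shows "(\<Sum>l\<in>S. Z l ** bidiag n M l j) = Z j - (if Suc j \<in> S then Z (Suc j) ** M else 0)"
proof -
  have "(\<Sum>l\<in>S. Z l ** bidiag n M l j)
      = (\<Sum>l\<in>S. (if l = j then Z l else 0) - (if l = Suc j then Z l ** M else 0))"
    using assms by (intro sum.cong) (auto simp: bidiag_def matrix_mult_uminus)
  then show ?thesis using assms(1,3) by (auto simp: sum_subtractf)
qed

text \<open>The property under the description operator in \<open>binv\<close>, named so that
  existence and uniqueness can be stated for it.\<close>

definition is_binv :: "nat set \<Rightarrow> 'n::finite bmat \<Rightarrow> 'n bmat \<Rightarrow> bool" where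
  "is_binv S X Y \<longleftrightarrow> (\<forall>i j. i \<notin> S \<or> j \<notin> S \<longrightarrow> Y i j = 0) \<and>
      (\<forall>i\<in>S. \<forall>j\<in>S. bmult S X Y i j = bid i j) \<and>
      (\<forall>i\<in>S. \<forall>j\<in>S. bmult S Y X i j = bid i j)"

lemma matrix_mult_sum_right: "A ** (\<Sum>l\<in>S. f l) = (\<Sum>l\<in>S. A ** (f l :: complex^'n^'n))"
  by (simp add: matrix_matrix_mult_def vec_eq_iff sum_distrib_left) (subst sum.swap, simp)

lemma matrix_mult_sum_left: "(\<Sum>l\<in>S. f l) ** A = (\<Sum>l\<in>S. f l ** (A :: complex^'n^'n))"
  by (simp add: matrix_matrix_mult_def vec_eq_iff sum_distrib_right) (subst sum.swap, simp)

text \<open>Inside \<open>S\<close>, \<open>Y' = (Y X) Y' = Y (X Y') = Y\<close>; elsewhere both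
  inverses are zero.\<close>

lemma is_binv_unique:
  assumes S: "finite S" and Y: "is_binv S X Y" and Y': "is_binv S X Y'"
  shows "Y = Y'"
proof -
  have "Y i j = Y' i j" if ij: "i \<in> S" "j \<in> S" for i j
  proof -
    have "Y' i j = (\<Sum>l\<in>S. (if i = l then Y' l j else 0))" using S ij by simp
    also have "\<dots> = (\<Sum>l\<in>S. bmult S Y X i l ** Y' l j)"
      using Y ij by (intro sum.cong) (auto simp: is_binv_def bid_def)
    also have "\<dots> = (\<Sum>l\<in>S. \<Sum>m\<in>S. Y i m ** (X m l ** Y' l j))"
      by (simp add: bmult_def matrix_mult_sum_left matrix_mul_assoc)
    also have "\<dots> = (\<Sum>m\<in>S. Y i m ** bmult S X Y' m j)"
      by (subst sum.swap) (simp add: bmult_def matrix_mult_sum_right)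
    also have "\<dots> = (\<Sum>m\<in>S. if m = j then Y i m else 0)"
      using Y' ij by (intro sum.cong) (auto simp: is_binv_def bid_def)
    also have "\<dots> = Y i j" using S ij by simp
    finally show ?thesis ..
  qed
  then have "Y i j = Y' i j" for i j
    using Y Y' by (cases "i \<in> S \<and> j \<in> S") (auto simp: is_binv_def)
  then show ?thesis by (simp add: fun_eq_iff)
qed

lemma is_binv_bidiag:
  assumes "S \<subseteq> {..<n}"
  shows "is_binv S (bidiag n M) (binv S (bidiag n M))"
proof -
  have S: "finite S" using assms finite_subset by blast
  \<comment> \<open>On \<open>S\<close> the matrix splits into one bidiagonal piece per run of
    consecutive indices, whose inverse consists of powers of \<open>M\<close>; entries linking
    different runs are zero.\<close>
  define Y where "Y i j = (if j \<in> S \<and> j \<le> i \<and> {j..i} \<subseteq> S then matpow M (i - j) else 0)" for i j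
  have split: "{j..i} = insert i {j..i - 1}" "{j..i} = insert j {Suc j..i}" if "j < i" for i j :: nat
    using that by auto
  have pow: "matpow M (i - j) = M ** matpow M (i - 1 - j)"
    "matpow M (i - j) = matpow M (i - Suc j) ** M" if "j < i" for i j
    using that matpow_Suc[of M "i - 1 - j"] matpow_Suc_right[of M "i - 1 - j"]
    by (simp_all add: Suc_diff_Suc)
  have "is_binv S (bidiag n M) Y"
    unfolding is_binv_def
  proof (intro conjI ballI allI impI)
    fix i j assume "i \<notin> S \<or> j \<notin> S"
    then show "Y i j = 0" by (auto simp: Y_def)
  next
    fix i j assume ij: "i \<in> S" "j \<in> S"
    then have "bmult S (bidiag n M) Y i j = Y i j - (if i > 0 \<and> i - 1 \<in> S then M ** Y (i - 1) j else 0)"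
      unfolding bmult_def by (intro sum_bidiag_left S assms)
    also have "\<dots> = bid i j"
    proof (cases i j rule: linorder_cases)
      case greater
      then show ?thesis
        using ij by (auto simp: Y_def bid_def split(1) pow(1))
    qed (use ij in \<open>auto simp: Y_def bid_def\<close>)
    finally show "bmult S (bidiag n M) Y i j = bid i j" .
  next
    fix i j assume ij: "i \<in> S" "j \<in> S"
    then have "bmult S Y (bidiag n M) i j = Y i j - (if Suc j \<in> S then Y i (Suc j) ** M else 0)"
      unfolding bmult_def by (intro sum_bidiag_right S assms)
    also have "\<dots> = bid i j"
    proof (cases i j rule: linorder_cases)
      case greater
      then show ?thesis
        using ij subsetD[of "{Suc j..i}" S "Suc j"] by (auto simp: Y_def bid_def split(2) pow(2))
    qed (use ij in \<open>auto simp: Y_def bid_def\<close>)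
    finally show "bmult S Y (bidiag n M) i j = bid i j" .
  qed
  then have "is_binv S (bidiag n M) (THE Y. is_binv S (bidiag n M) Y)"
    by (rule theI[where a = Y]) (rule is_binv_unique[OF S _ \<open>is_binv S (bidiag n M) Y\<close>])
  then show ?thesis
    by (simp add: binv_def is_binv_def[abs_def])
qed

text \<open>Replaces the inverse by time stepping inside \<open>S\<close>, read off from the rows of
  the right-inverse identity. A predecessor outside \<open>S\<close> contributes zero.\<close>

lemma binv_apply:
  assumes "S \<subseteq> {..<n}" "y = (\<lambda>i. \<Sum>j\<in>S. binv S (bidiag n M) i j *v v j)"
  shows "i \<notin> S \<Longrightarrow> y i = 0" and "i \<in> S \<Longrightarrow> y i = v i + M *v shift 1 y i"
proof -
  let ?Y = "binv S (bidiag n M)"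
  have S: "finite S" using assms finite_subset by blast
  note Y = is_binv_bidiag[OF assms(1), of M]
  have out: "y i = 0" if "i \<notin> S" for i
    using Y that by (auto simp: is_binv_def assms(2))
  then show "i \<notin> S \<Longrightarrow> y i = 0" .
  assume i: "i \<in> S"
  then have L: "(\<Sum>l\<in>S. (bidiag n M i l ** ?Y l j)) = ?Y i j - (if i > 0 \<and> i - 1 \<in> S then M ** ?Y (i - 1) j else 0)" for j
    by (intro sum_bidiag_left S assms)
  have "(\<Sum>l\<in>S. (bidiag n M i l ** ?Y l j)) = bid i j" if "j \<in> S" for j
    using Y i that by (simp add: is_binv_def bmult_def)
  then have YL: "?Y i j = bid i j + (if i > 0 \<and> i - 1 \<in> S then M ** ?Y (i - 1) j else 0)" if "j \<in> S" for j
    using that L[of j] by (simp only: eq_diff_eq)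
  have "y i = (\<Sum>j\<in>S. bid i j *v v j + (if i > 0 \<and> i - 1 \<in> S then M *v (?Y (i - 1) j *v v j) else 0))"
    unfolding assms(2) using YL
    by (intro sum.cong) (auto simp: matrix_vector_mult_add_rdistrib matrix_vector_mul_assoc)
  then have sum: "y i = (\<Sum>j\<in>S. bid i j *v v j) + (if i > 0 \<and> i - 1 \<in> S then M *v y (i - 1) else 0)"
    by (simp add: sum.distrib mult_vec_sum assms(2))
  have "(\<Sum>j\<in>S. bid i j *v v j) = (\<Sum>j\<in>S. if i = j then v j else 0)"
    by (rule sum.cong) (auto simp: bid_def)
  then have "(\<Sum>j\<in>S. bid i j *v v j) = v i" using i S by simp
  moreover have "(if i > 0 \<and> i - 1 \<in> S then M *v y (i - 1) else 0) = M *v shift 1 y i"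
    using out[of "i - 1"] by (auto simp: shift_def)
  ultimately show "y i = v i + M *v shift 1 y i"
    using sum by (simp only:)
qed

lemma binv_bapply:
  assumes "S \<subseteq> {..<n}"
  shows "bapply n (binv S (bidiag n M)) v = (\<lambda>i. \<Sum>j\<in>S. binv S (bidiag n M) i j *v v j)"
proof
  fix i
  show "bapply n (binv S (bidiag n M)) v i = (\<Sum>j\<in>S. binv S (bidiag n M) i j *v v j)"
    unfolding bapply_def using is_binv_bidiag[OF assms, of M]
    by (intro sum.mono_neutral_right) (auto simp: is_binv_def assms)
qed

subsection \<open>Residuals of the relaxation sweeps\<close>

text \<open>The form of a residual that vanishes at the F-points; F-relaxation always produces
  it.\<close>

definition C_embed :: "nat \<Rightarrow> nat \<Rightarrow> 'n::finite bvec \<Rightarrow> 'n bvec" where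
  "C_embed k Nc f i = (if i < num_times k Nc \<and> k dvd i then f (i div k) else 0)"

lemma adjoint_mat_inner:
  fixes M :: "complex^'n^'n"
  shows "(\<Sum>a\<in>UNIV. (adjoint_mat M *v u) $ a * cnj (v $ a)) = (\<Sum>a\<in>UNIV. u $ a * cnj ((M *v v) $ a))"
proof -
  have "(\<Sum>a\<in>UNIV. (adjoint_mat M *v u) $ a * cnj (v $ a)) = (\<Sum>a\<in>UNIV. \<Sum>b\<in>UNIV. cnj (M $ b $ a) * u $ b * cnj (v $ a))"
    by (simp add: adjoint_mat_def matrix_vector_mult_def transpose_def map_matrix_def sum_distrib_right)
  also have "\<dots> = (\<Sum>a\<in>UNIV. u $ a * cnj ((M *v v) $ a))"
    by (subst sum.swap) (simp add: matrix_vector_mult_def sum_distrib_left mult_ac)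
  finally show ?thesis .
qed

lemma sum_mult_cnj: "(\<Sum>a\<in>UNIV. v $ a * cnj (v $ a)) = of_real ((norm (v :: complex^'n))\<^sup>2)"
  by (simp add: norm_vec_sq complex_norm_square del: of_real_power)

lemma binner_badjoint: "binner n (bapply n (bmult {..<n} (badjoint X) X) u) u = of_real ((bnorm n (bapply n X u))\<^sup>2)"
proof -
  define w where "w = bapply n X u"
  have "binner n (bapply n (bmult {..<n} (badjoint X) X) u) u
      = (\<Sum>j<n. \<Sum>a\<in>UNIV. \<Sum>l<n. (adjoint_mat (X l j) *v w l) $ a * cnj (u j $ a))"
    unfolding bapply_bmult_lessThan w_def[symmetric]
    unfolding binner_def bapply_def[of n "badjoint X"] by (simp add: badjoint_def sum_distrib_right)
  also have "\<dots> = (\<Sum>j<n. \<Sum>l<n. \<Sum>a\<in>UNIV. (adjoint_mat (X l j) *v w l) $ a * cnj (u j $ a))"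
    by (intro sum.cong refl sum.swap)
  also have "\<dots> = (\<Sum>l<n. \<Sum>j<n. \<Sum>a\<in>UNIV. w l $ a * cnj ((X l j *v u j) $ a))"
    unfolding adjoint_mat_inner by (rule sum.swap)
  also have "\<dots> = (\<Sum>l<n. \<Sum>a\<in>UNIV. \<Sum>j<n. w l $ a * cnj ((X l j *v u j) $ a))"
    by (intro sum.cong refl sum.swap)
  also have "\<dots> = (\<Sum>l<n. \<Sum>a\<in>UNIV. w l $ a * cnj (w l $ a))"
    by (simp add: w_def bapply_def sum_distrib_left)
  also have "\<dots> = of_real ((bnorm n w)\<^sup>2)"
    by (simp add: sum_mult_cnj bnorm_sq del: of_real_power)
  finally show ?thesis by (simp add: w_def)
qed

text \<open>The quadratic form is the squared residual norm by \<open>binner_badjoint\<close>. This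
  is why error ratios and residual ratios coincide.\<close>

lemma norm_AA_eq: "norm_AA k Nc \<Phi> e = bnorm (num_times k Nc) (bapply (num_times k Nc) (system_mat k Nc \<Phi>) e)"
  by (simp add: norm_AA_def Let_def binner_badjoint bnorm_nonneg del: of_real_power)

section \<open>The fine grid and its C-points\<close>

context
  fixes k Nc :: nat and \<Phi> :: "complex^'n^'n"
  assumes k: "k \<ge> 2" and Nc: "Nc \<ge> 1"
begin

private abbreviation (input) "N \<equiv> num_times k Nc"
private abbreviation (input) "A \<equiv> system_mat k Nc \<Phi>"
private abbreviation (input) "FP \<equiv> F_points k Nc"
private abbreviation (input) "CP \<equiv> C_points k Nc"

lemma C_point_less: "J * k < N \<longleftrightarrow> J < Nc"
proof
  assume "J < Nc"
  then have "J * k \<le> (Nc - 1) * k" by (intro mult_right_mono) auto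
  then show "J * k < N" unfolding num_times_def by linarith
next
  assume "J * k < N"
  then have "J * k \<le> (Nc - 1) * k" unfolding num_times_def by linarith
  then have "J \<le> Nc - 1" using k by simp
  then show "J < Nc" using Nc by simp
qed

lemma points_subset: "FP \<subseteq> {..<N}" "CP \<subseteq> {..<N}"
  by (auto simp: F_points_def C_points_def)

lemma point_cases:
  obtains "i \<ge> N" | "i \<in> FP" | J where "i = J * k" "J < Nc"
proof (cases "i < N \<and> k dvd i")
  case True
  then obtain J where "i = J * k" by (metis dvd_def mult.commute)
  then show ?thesis using that True C_point_less by blast
qed (use that in \<open>force simp: F_points_def\<close>)

lemma C_point_notin: "J * k \<notin> FP"
  by (simp add: F_points_def)

lemma C_embed_C_point: "J < Nc \<Longrightarrow> C_embed k Nc f (J * k) = f J"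
  using k by (simp add: C_embed_def C_point_less)

lemma C_embed_F_point: "i \<in> FP \<Longrightarrow> C_embed k Nc f i = 0"
  by (simp add: C_embed_def F_points_def)

lemma C_embed_outside: "i \<ge> N \<Longrightarrow> C_embed k Nc f i = 0"
  by (simp add: C_embed_def)

lemma C_embed_eqI:
  assumes "\<And>i. i \<ge> N \<Longrightarrow> r i = 0" "\<And>i. i \<in> FP \<Longrightarrow> r i = 0" "\<And>J. J < Nc \<Longrightarrow> r (J * k) = f J"
  shows "r = C_embed k Nc f"
proof
  fix i
  show "r i = C_embed k Nc f i"
    by (rule point_cases[of i]) (simp_all add: assms C_embed_C_point C_embed_F_point C_embed_outside)
qed

lemma C_embed_cong: "(\<And>J. J < Nc \<Longrightarrow> f J = g J) \<Longrightarrow> C_embed k Nc f = C_embed k Nc g"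
  by (rule C_embed_eqI) (simp_all add: C_embed_C_point C_embed_F_point C_embed_outside)

lemma sum_C_points: "(\<Sum>i<N. if k dvd i then g (i div k) else 0) = (\<Sum>J<Nc. g J :: 'b :: comm_monoid_add)"
proof -
  have "(\<Sum>i<N. if k dvd i then g (i div k) else 0) = (\<Sum>i\<in>{i. i < N \<and> k dvd i}. g (i div k))"
    by (rule sum.mono_neutral_cong_right) auto
  also have "\<dots> = (\<Sum>J<Nc. g J)"
    using k by (intro sum.reindex_bij_witness[of _ "\<lambda>J. J * k" "\<lambda>i. i div k"])
      (auto simp: C_point_less[symmetric])
  finally show ?thesis .
qed

lemma bnorm_embed: "bnorm N (C_embed k Nc f) = bnorm Nc f"
proof -
  have "(bnorm N (C_embed k Nc f))\<^sup>2 = (\<Sum>i<N. if k dvd i then (norm (f (i div k)))\<^sup>2 else 0)"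
    unfolding bnorm_sq by (intro sum.cong) (auto simp: C_embed_def)
  also have "\<dots> = (bnorm Nc f)\<^sup>2"
    unfolding sum_C_points[of "\<lambda>J. (norm (f J))\<^sup>2"] by (simp add: bnorm_sq)
  finally show ?thesis by (simp add: bnorm_nonneg)
qed

lemma A_apply: "bapply N A v i = (if i < N then v i - \<Phi> *v shift 1 v i else 0)"
  by (simp add: system_mat_def bapply_bidiag)

text \<open>Forward substitution with \<Phi> solves the fine system. Hence any coarse vector can be
  prescribed as initial residual, which the necessary conditions rely on.\<close>

lemma A_surj: "\<exists>e\<in>block_vecs N. bapply N A e = C_embed k Nc f"
proof
  define e where "e i = (if i < N then solve \<Phi> (C_embed k Nc f) i else 0)" for i
  show "e \<in> block_vecs N" by (simp add: block_vecs_def e_def)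
  have "shift 1 e i = shift 1 (solve \<Phi> (C_embed k Nc f)) i" if "i < N" for i
    using that by (simp add: shift_def e_def)
  then have "bapply N A e i = C_embed k Nc f i" for i
    by (simp add: A_apply e_def solve_residual C_embed_outside)
  then show "bapply N A e = C_embed k Nc f" by blast
qed

section \<open>Relaxation as a map of residuals\<close>

definition relax :: "'n bmat \<Rightarrow> 'n bvec \<Rightarrow> 'n bvec" where
  "relax Mi r = (\<lambda>i. r i - bapply N A (bapply N Mi r) i)"

text \<open>\<open>A (I - M A) = (I - A M) A\<close> for every correction matrix \<open>M\<close>,
  so the residuals evolve without reference to the errors.\<close>

lemma residual_propagator:
  "bapply N A (bapply N (propagator k Nc \<Phi> Mi) e) = relax Mi (bapply N A e)"
proof -
  have "bapply N (propagator k Nc \<Phi> Mi) e i = e i - bapply N Mi (bapply N A e) i" if "i < N" for i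
  proof -
    have "bapply N (propagator k Nc \<Phi> Mi) e i = bapply N bid e i - bapply N (bmult {..<N} Mi A) e i"
      by (simp add: propagator_def bminus_def bapply_def matrix_vector_mult_diff_rdistrib sum_subtractf)
    then show ?thesis using that by (simp add: bapply_bid bapply_bmult_lessThan)
  qed
  then have "bapply N A (bapply N (propagator k Nc \<Phi> Mi) e) = bapply N A (\<lambda>i. e i - bapply N Mi (bapply N A e) i)"
    by (rule bapply_cong)
  then show ?thesis by (simp add: relax_def fun_eq_iff bapply_minus)
qed

text \<open>\<open>y\<close> is the correction computed on the F-points. It removes the residual
  there, and a C-point only receives the value stepped from its predecessor.\<close>

lemma F_relax:
  fixes r :: "'n bvec"
  assumes r: "\<And>i. i \<ge> N \<Longrightarrow> r i = 0"
  obtains y where "relax (MF_inv k Nc \<Phi>) r = C_embed k Nc (\<lambda>J. r (J * k) + \<Phi> *v shift 1 y (J * k))"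
    and "\<And>i. i \<notin> FP \<Longrightarrow> y i = 0" and "\<And>i. i \<in> FP \<Longrightarrow> y i = r i + \<Phi> *v shift 1 y i"
proof -
  define y where "y = bapply N (MF_inv k Nc \<Phi>) r"
  have y_sum: "y = (\<lambda>i. \<Sum>j\<in>FP. binv FP (bidiag N \<Phi>) i j *v r j)"
    unfolding y_def MF_inv_def system_mat_def by (rule binv_bapply) (rule points_subset)
  have y: "y i = 0" if "i \<notin> FP" for i
    by (rule binv_apply(1)[OF points_subset(1) y_sum that])
  have yF: "y i = r i + \<Phi> *v shift 1 y i" if "i \<in> FP" for i
    by (rule binv_apply(2)[OF points_subset(1) y_sum that])
  have "relax (MF_inv k Nc \<Phi>) r = C_embed k Nc (\<lambda>J. r (J * k) + \<Phi> *v shift 1 y (J * k))"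
  proof (rule C_embed_eqI)
    fix i assume "i \<in> FP"
    then have "i < N" "y i = r i + \<Phi> *v shift 1 y i" using points_subset yF by auto
    then show "relax (MF_inv k Nc \<Phi>) r i = 0"
      unfolding relax_def y_def[symmetric] A_apply by simp
  next
    fix J assume "J < Nc"
    then show "relax (MF_inv k Nc \<Phi>) r (J * k) = r (J * k) + \<Phi> *v shift 1 y (J * k)"
      unfolding relax_def y_def[symmetric] A_apply by (simp add: C_point_less y C_point_notin)
  qed (simp add: relax_def A_apply r)
  then show ?thesis using that y yF by blast
qed

text \<open>With no residual on the F-points, forward substitution there yields a zero correction.
  So the leading F-relaxation is inert from the second iteration on.\<close>

lemma F_relax_embed: "relax (MF_inv k Nc \<Phi>) (C_embed k Nc f) = C_embed k Nc f"
proof (rule F_relax[of "C_embed k Nc f"])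
  fix y
  assume y: "relax (MF_inv k Nc \<Phi>) (C_embed k Nc f)
        = C_embed k Nc (\<lambda>J. C_embed k Nc f (J * k) + \<Phi> *v shift 1 y (J * k))"
      "\<And>i. i \<notin> FP \<Longrightarrow> y i = 0" "\<And>i. i \<in> FP \<Longrightarrow> y i = C_embed k Nc f i + \<Phi> *v shift 1 y i"
  have y0: "y i = 0" for i
  proof (induction i)
    case (Suc i)
    then show ?case
      using y(2)[of "Suc i"] y(3)[of "Suc i"] by (cases "Suc i \<in> FP") (simp_all add: C_embed_F_point)
  qed (use y(2)[of 0] in \<open>simp add: F_points_def\<close>)
  show ?thesis unfolding y(1) by (rule C_embed_cong) (simp add: C_embed_C_point y0 shift_def)
qed (rule C_embed_outside)

lemma propagated:
  assumes "\<And>i. i \<in> FP \<Longrightarrow> x i = \<Phi> *v x (i - 1)" "m < k" "J * k + m < N"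
  shows "x (J * k + m) = matpow \<Phi> m *v x (J * k)"
  using assms(2,3)
proof (induction m)
  case (Suc m)
  have "\<not> k dvd J * k + Suc m"
    using Suc.prems(1) by (metis dvd_add_right_iff dvd_triv_right nat_dvd_not_less zero_less_Suc)
  then have "x (J * k + Suc m) = \<Phi> *v x (J * k + m)"
    using assms(1)[of "J * k + Suc m"] Suc.prems by (simp add: F_points_def)
  then show ?case using Suc by (simp add: matrix_vector_mul_assoc)
qed simp

text \<open>Between neighbouring C-points lie \<open>k - 1\<close> steps to F-points and one last
  step, \<open>k\<close> factors of \<Phi> in all; at \<open>J = 0\<close> both shifts
  vanish.\<close>

lemma propagated_last:
  assumes "\<And>i. i \<in> FP \<Longrightarrow> x i = \<Phi> *v x (i - 1)" "J < Nc"
  shows "\<Phi> *v shift 1 x (J * k) = matpow \<Phi> k *v shift 1 (\<lambda>J. x (J * k)) J"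
proof (cases J)
  case (Suc I)
  have e: "J * k - 1 = I * k + (k - 1)" using k Suc by simp
  have "I * k + (k - 1) < N"
    using C_point_less[of J] assms(2) Suc k by simp
  then have "x (J * k - 1) = matpow \<Phi> (k - 1) *v x (I * k)"
    unfolding e using k by (intro propagated assms(1)) auto
  moreover have "matpow \<Phi> k = \<Phi> ** matpow \<Phi> (k - 1)"
    using k matpow_Suc[of \<Phi> "k - 1"] by simp
  ultimately show ?thesis using k Suc by (simp add: shift_def matrix_vector_mul_assoc)
qed (simp add: shift_def)

text \<open>C-relaxation hands the residual of each C-point to the F-point after it, and
  F-relaxation carries it on to the next C-point.\<close>

lemma C_relax:
  "relax (MF_inv k Nc \<Phi>) (relax (MC_inv k Nc \<Phi>) (C_embed k Nc f)) = C_embed k Nc (\<lambda>J. matpow \<Phi> k *v shift 1 f J)"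
proof -
  define r where "r = C_embed k Nc f"
  define y where "y = bapply N (MC_inv k Nc \<Phi>) r"
  have y_sum: "y = (\<lambda>i. \<Sum>j\<in>CP. binv CP (bidiag N \<Phi>) i j *v r j)"
    unfolding y_def MC_inv_def system_mat_def by (rule binv_bapply) (rule points_subset)
  \<comment> \<open>C-points are never adjacent because \<open>k \<ge> 2\<close>. Thus
    \<open>A_cc\<close> is the identity and the correction \<open>y\<close> is the residual
    itself.\<close>
  have pred: "shift 1 g i = 0" if "i \<in> CP" "\<And>j. j \<notin> CP \<Longrightarrow> g j = 0" for i and g :: "'n bvec"
  proof (cases i)
    case (Suc j)
    have "\<not> k dvd j"
      using that(1) k Suc by (auto simp: C_points_def dest: dvd_diff_nat[of k "Suc j" j])
    then show ?thesis using that(2)[of j] Suc by (simp add: shift_def C_points_def)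
  qed (simp add: shift_def)
  have r: "r i = 0" if "i \<notin> CP" for i
    using that by (auto simp: r_def C_embed_def C_points_def)
  have y0: "y i = 0" if "i \<notin> CP" for i
    by (rule binv_apply(1)[OF points_subset(2) y_sum that])
  have yC: "y i = r i" if "i \<in> CP" for i
    using binv_apply(2)[OF points_subset(2) y_sum that] pred[OF that, of y, OF y0] by simp
  have "y = r"
  proof
    fix i
    show "y i = r i" by (cases "i \<in> CP") (simp_all only: yC y0 r not_False_eq_True)
  qed
  then have r': "relax (MC_inv k Nc \<Phi>) r = (\<lambda>i. if i < N then \<Phi> *v shift 1 r i else 0)"
    unfolding relax_def y_def[symmetric] A_apply by (auto simp: r_def C_embed_outside)
  define r' where "r' = (\<lambda>i. if i < N then \<Phi> *v shift 1 r i else 0)"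
  obtain z where z: "relax (MF_inv k Nc \<Phi>) r' = C_embed k Nc (\<lambda>J. r' (J * k) + \<Phi> *v shift 1 z (J * k))"
      "\<And>i. i \<notin> FP \<Longrightarrow> z i = 0" "\<And>i. i \<in> FP \<Longrightarrow> z i = r' i + \<Phi> *v shift 1 z i"
    using F_relax[of r'] by (auto simp: r'_def)
  \<comment> \<open>The sum satisfies the homogeneous fine recursion on the F-points, restarted from
    \<open>r\<close> at each C-point.\<close>
  define x where "x i = r i + z i" for i
  have x: "x i = \<Phi> *v x (i - 1)" if "i \<in> FP" for i
  proof -
    have "i < N" "i > 0" "i \<notin> CP" using that by (auto simp: F_points_def C_points_def intro: gr0I)
    then show ?thesis
      using z(3)[OF that] r[of i] by (simp add: x_def r'_def shift_def matrix_vector_right_distrib)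
  qed
  show ?thesis
    unfolding r_def[symmetric] r' r'_def[symmetric] z(1)
  proof (rule C_embed_cong)
    fix J assume J: "J < Nc"
    have "r' (J * k) + \<Phi> *v shift 1 z (J * k) = \<Phi> *v shift 1 x (J * k)"
      using J by (simp add: r'_def C_point_less x_def shift_def matrix_vector_right_distrib)
    also have "\<dots> = matpow \<Phi> k *v shift 1 (\<lambda>J. x (J * k)) J"
      using x J by (rule propagated_last)
    also have "shift 1 (\<lambda>J. x (J * k)) J = shift 1 f J"
      using J by (simp add: shift_def x_def z(2) C_point_notin r_def C_embed_C_point)
    finally show "r' (J * k) + \<Phi> *v shift 1 z (J * k) = matpow \<Phi> k *v shift 1 f J" .
  qed
qed

section \<open>Coarse-grid correction\<close>

lemma coarse_solve:
  assumes "J < Nc"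
  shows "bapply Nc (binv {..<Nc} (coarse_mat Nc \<Psi>)) f J = solve \<Psi> f J"
proof -
  define y where "y = bapply Nc (binv {..<Nc} (coarse_mat Nc \<Psi>)) f"
  have y_sum: "y = (\<lambda>i. \<Sum>j<Nc. binv {..<Nc} (bidiag Nc \<Psi>) i j *v f j)"
    unfolding y_def coarse_mat_def by (rule binv_bapply) simp
  have y: "y J = f J + \<Psi> *v shift 1 y J" if "J < Nc" for J
    by (rule binv_apply(2)[OF order.refl y_sum]) (simp add: that)
  show ?thesis
    unfolding y_def[symmetric] using assms
  proof (induction J)
    case (Suc J)
    then show ?case using y[of "Suc J"] by (simp add: add.commute)
  qed (use y[of 0] in simp)
qed

text \<open>The F-rows \<open>- A_ff^-1 A_fc\<close> solve the homogeneous fine recursion with the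
  coarse values as starting data: this is ideal interpolation.\<close>

lemma interp_apply:
  fixes z :: "'n bvec"
  defines "x \<equiv> \<lambda>i. \<Sum>J<Nc. interp k Nc \<Phi> i J *v z J"
  shows "J < Nc \<Longrightarrow> x (J * k) = z J" and "i \<in> FP \<Longrightarrow> x i = \<Phi> *v x (i - 1)"
proof -
  have xC: "x (J * k) = z J" if "J < Nc" for J
  proof -
    have "x (J * k) = (\<Sum>I<Nc. if I = J then z I else 0)"
      unfolding x_def using k by (intro sum.cong) (auto simp: interp_def C_point_notin)
    then show ?thesis using that by simp
  qed
  then show "J < Nc \<Longrightarrow> x (J * k) = z J" .
  define g where "g l = (\<Sum>J<Nc. A l (J * k) *v z J)" for l
  define y where "y = (\<lambda>i. \<Sum>j\<in>FP. binv FP (bidiag N \<Phi>) i j *v g j)"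
  have xF: "x i = - y i" if "i \<in> FP" for i
  proof -
    have "x i = (\<Sum>J<Nc. - (\<Sum>l\<in>FP. MF_inv k Nc \<Phi> i l *v (A l (J * k) *v z J)))"
      unfolding x_def using that
      by (intro sum.cong) (auto simp: interp_def bmult_def mult_vec_uminus_left sum_mult_vec matrix_vector_mul_assoc)
    also have "\<dots> = - (\<Sum>J<Nc. \<Sum>l\<in>FP. MF_inv k Nc \<Phi> i l *v (A l (J * k) *v z J))"
      by (rule sum_negf)
    also have "(\<Sum>J<Nc. \<Sum>l\<in>FP. MF_inv k Nc \<Phi> i l *v (A l (J * k) *v z J)) = y i"
      by (subst sum.swap) (simp add: y_def g_def mult_vec_sum MF_inv_def system_mat_def)
    finally show ?thesis .
  qed
  assume i: "i \<in> FP"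
  then have i': "i < N" "i > 0" "i - 1 < N" by (auto simp: F_points_def intro: gr0I)
  have y: "y i = g i + \<Phi> *v y (i - 1)"
    using binv_apply(2)[OF points_subset(1) y_def i] i' by (simp add: shift_def)
  \<comment> \<open>A row of \<open>A_fc\<close> is nonzero only for an F-point that directly
    follows a C-point.\<close>
  have A: "A i (J * k) = (if J * k = i - 1 then - \<Phi> else 0)" if "J < Nc" for J
    using i i' that C_point_notin[of J] by (auto simp: system_mat_def bidiag_def C_point_less)
  show "x i = \<Phi> *v x (i - 1)"
  proof (cases "i - 1 \<in> FP")
    case True
    then have "J * k \<noteq> i - 1" for J using C_point_notin[of J] by metis
    then have "g i = 0"
      unfolding g_def by (intro sum.neutral) (simp add: A)
    then show ?thesis using xF[OF i] xF[OF True] y by (simp add: mult_vec_uminus_right)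
  next
    case False
    then obtain I where I: "i - 1 = I * k" "I < Nc"
      using i' False by - (rule point_cases[of "i - 1"], auto)
    have "y (i - 1) = 0"
      by (rule binv_apply(1)[OF points_subset(1) y_def False])
    moreover have "J * k = i - 1 \<longleftrightarrow> J = I" for J using I(1) k by simp
    then have "g i = (\<Sum>J<Nc. if J = I then - (\<Phi> *v z J) else 0)"
      unfolding g_def by (intro sum.cong) (auto simp: A mult_vec_uminus_left)
    ultimately have "y i = - (\<Phi> *v z I)" using y I(2) by simp
    then show ?thesis using xF[OF i] xC[OF I(2)] I(1) by simp
  qed
qed

text \<open>The interpolated correction satisfies the fine equations on the F-points, so no residual
  arises there. At the C-points \<open>f = z - \<Psi> L z\<close>, while the correction removes
  \<open>z - \<Phi>^k L z\<close>; the difference is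
  \<open>- (\<Psi> - \<Phi>^k) L z\<close>.\<close>

lemma coarse_correction:
  fixes \<Psi> :: "complex^'n^'n"
  shows "relax (Mcgc_inv k Nc \<Phi> \<Psi>) (C_embed k Nc f)
    = C_embed k Nc (shift 1 (\<lambda>J. - ((\<Psi> - matpow \<Phi> k) *v solve \<Psi> f J)))"
proof -
  define z where "z = bapply Nc (binv {..<Nc} (coarse_mat Nc \<Psi>)) f"
  define x where "x = (\<lambda>i. \<Sum>J<Nc. interp k Nc \<Phi> i J *v z J)"
  have inj: "bapply N (inject k Nc) (C_embed k Nc f) J = f J" if "J < Nc" for J
  proof -
    have "bapply N (inject k Nc) (C_embed k Nc f) J = (\<Sum>i<N. if i = J * k then f J else 0)"
      unfolding bapply_def using that by (intro sum.cong) (auto simp: inject_def C_embed_C_point)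
    then show ?thesis using that by (simp add: C_point_less)
  qed
  have x: "bapply N (Mcgc_inv k Nc \<Phi> \<Psi>) (C_embed k Nc f) i = x i" for i
  proof -
    have "bapply N (Mcgc_inv k Nc \<Phi> \<Psi>) (C_embed k Nc f) i
        = (\<Sum>J<Nc. bmult {..<Nc} (interp k Nc \<Phi>) (binv {..<Nc} (coarse_mat Nc \<Psi>)) i J *v f J)"
      unfolding Mcgc_inv_def bapply_bmult by (simp add: inj)
    also have "\<dots> = bapply Nc (bmult {..<Nc} (interp k Nc \<Phi>) (binv {..<Nc} (coarse_mat Nc \<Psi>))) f i"
      by (simp add: bapply_def)
    also have "\<dots> = x i"
      unfolding bapply_bmult x_def z_def ..
    finally show ?thesis .
  qed
  have xC: "x (J * k) = z J" if "J < Nc" for J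
    unfolding x_def using that by (rule interp_apply(1))
  have xF: "x i = \<Phi> *v x (i - 1)" if "i \<in> FP" for i
    unfolding x_def using that by (rule interp_apply(2))
  show ?thesis
  proof (rule C_embed_eqI)
    fix i assume i: "i \<ge> N"
    then show "relax (Mcgc_inv k Nc \<Phi> \<Psi>) (C_embed k Nc f) i = 0"
      by (simp add: relax_def A_apply C_embed_outside)
  next
    fix i assume i: "i \<in> FP"
    then have "i < N" "i > 0" by (auto simp: F_points_def intro: gr0I)
    then show "relax (Mcgc_inv k Nc \<Phi> \<Psi>) (C_embed k Nc f) i = 0"
      using xF[OF i] by (simp add: relax_def A_apply C_embed_F_point[OF i] x[abs_def] shift_def)
  next
    fix J assume J: "J < Nc"
    have s: "shift 1 (\<lambda>J. x (J * k)) J = shift 1 (solve \<Psi> f) J"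
      using J by (simp add: shift_def xC z_def coarse_solve)
    have "relax (Mcgc_inv k Nc \<Phi> \<Psi>) (C_embed k Nc f) (J * k) = f J - (z J - \<Phi> *v shift 1 x (J * k))"
      using J by (simp add: relax_def A_apply C_embed_C_point C_point_less x[abs_def] xC)
    also have "\<Phi> *v shift 1 x (J * k) = matpow \<Phi> k *v shift 1 (solve \<Psi> f) J"
      using propagated_last[where x = x, OF xF J] by (simp only: s)
    also have "z J = solve \<Psi> f J"
      using J by (simp add: z_def coarse_solve)
    also have "f J - (solve \<Psi> f J - matpow \<Phi> k *v shift 1 (solve \<Psi> f) J)
        = shift 1 (\<lambda>J. - ((\<Psi> - matpow \<Phi> k) *v solve \<Psi> f J)) J"
      by (cases J) (simp_all add: matrix_vector_mult_diff_rdistrib)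
    finally show "relax (Mcgc_inv k Nc \<Phi> \<Psi>) (C_embed k Nc f) (J * k)
        = shift 1 (\<lambda>J. - ((\<Psi> - matpow \<Phi> k) *v solve \<Psi> f J)) J" .
  qed
qed

lemma residual_E_F:
  "bapply N A (bapply N (E_F k Nc \<Phi> \<Psi>) e)
    = relax (Mcgc_inv k Nc \<Phi> \<Psi>) (relax (MF_inv k Nc \<Phi>) (bapply N A e))"
  by (simp add: E_F_def bapply_bmult_lessThan residual_propagator)

lemma residual_E_FCF:
  "bapply N A (bapply N (E_FCF k Nc \<Phi> \<Psi>) e)
    = relax (Mcgc_inv k Nc \<Phi> \<Psi>) (relax (MF_inv k Nc \<Phi>)
        (relax (MC_inv k Nc \<Phi>) (relax (MF_inv k Nc \<Phi>) (bapply N A e))))"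
  by (simp add: E_FCF_def bapply_bmult_lessThan residual_propagator residual_E_F)

lemma F_relax_ex: "\<exists>f. relax (MF_inv k Nc \<Phi>) (bapply N A e) = C_embed k Nc f"
  by (rule F_relax[of "bapply N A e"]) (auto simp: A_apply)

end

subsection \<open>Convergence conditions\<close>

text \<open>The actual rate is O(1/n), which is stronger than required. The finitely many values up
  to \<open>b\<close> do not affect the order and are free to make short grids trivial.\<close>

lemma inv_sqrt_order_ex:
  assumes "K \<ge> 0" "B \<ge> 0"
  obtains \<epsilon> where "inv_sqrt_order \<epsilon>" and "\<And>n. n > b \<Longrightarrow> \<epsilon> n = K / real (n - b)" and "\<And>n. n \<le> b \<Longrightarrow> \<epsilon> n = B"
proof
  define \<epsilon> where "\<epsilon> n = (if n > b then K / real (n - b) else B)" for n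
  show "\<And>n. n > b \<Longrightarrow> \<epsilon> n = K / real (n - b)" "\<And>n. n \<le> b \<Longrightarrow> \<epsilon> n = B"
    by (simp_all add: \<epsilon>_def)
  \<comment> \<open>Beyond \<open>2 * b\<close> one has \<open>n \<le> 2 * (n - b)\<close>, and the
    square root of \<open>n\<close> is at most \<open>n\<close>.\<close>
  have "\<epsilon> n \<le> 2 * K * (1 / sqrt (real n))" if n: "n > 2 * b" for n
  proof -
    have n1: "real n \<ge> 1" using n by linarith
    have "sqrt (real n) \<le> sqrt ((real n)\<^sup>2)"
      using n1 self_le_power[of "real n" 2] by (intro real_sqrt_le_mono) simp
    then have "sqrt (real n) \<le> 2 * real (n - b)"
      using n by simp
    then have "K * sqrt (real n) \<le> K * (2 * real (n - b))"
      using assms(1) by (rule mult_left_mono)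
    then show ?thesis
      using n n1 by (simp add: \<epsilon>_def field_simps)
  qed
  moreover have "0 \<le> \<epsilon> n" for n using assms by (simp add: \<epsilon>_def)
  ultimately have "\<epsilon> \<in> O(\<lambda>n. 1 / sqrt (real n))"
    by (intro bigoI[of _ "2 * K"] eventually_mono[OF eventually_gt_at_top[of "2 * b"]]) simp
  then show "inv_sqrt_order \<epsilon>"
    using \<open>\<And>n. 0 \<le> \<epsilon> n\<close> by (simp add: inv_sqrt_order_def)
qed

text \<open>What both methods share: one step from any error puts the residual into the range of
  \<open>T\<close> on the C-points, and from then on a step acts on the residual as
  \<open>T\<close>.\<close>

locale error_iteration = residual_map \<Psi> D G H s q
  for \<Psi> D G H :: "complex^'n^'n" and s q :: nat +
  fixes k :: nat and \<Phi> :: "complex^'n^'n" and E :: "nat \<Rightarrow> 'n bmat"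
  assumes k: "k \<ge> 2"
    and step_range: "Nc \<ge> 1 \<Longrightarrow> \<exists>f. bapply (num_times k Nc) (system_mat k Nc \<Phi>)
        (bapply (num_times k Nc) (E Nc) e) = C_embed k Nc (T f)"
    and step_embed: "Nc \<ge> 1 \<Longrightarrow> bapply (num_times k Nc) (system_mat k Nc \<Phi>) e = C_embed k Nc f \<Longrightarrow>
        bapply (num_times k Nc) (system_mat k Nc \<Phi>) (bapply (num_times k Nc) (E Nc) e) = C_embed k Nc (T f)"
begin

definition res :: "nat \<Rightarrow> 'n bvec \<Rightarrow> nat \<Rightarrow> 'n bvec" where
  "res Nc e i = bapply (num_times k Nc) (system_mat k Nc \<Phi>) ((bapply (num_times k Nc) (E Nc) ^^ i) e)"

abbreviation rnorm :: "nat \<Rightarrow> 'n bvec \<Rightarrow> nat \<Rightarrow> real" where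
  "rnorm Nc e i \<equiv> bnorm (num_times k Nc) (res Nc e i)"

lemma res_Suc:
  assumes "Nc \<ge> 1" "res Nc e i = C_embed k Nc f"
  shows "res Nc e (Suc i) = C_embed k Nc (T f)"
  using step_embed[OF assms(1)] assms(2) by (simp add: res_def)

lemma res_range:
  assumes "Nc \<ge> 1" "i \<ge> 1"
  shows "\<exists>f. res Nc e i = C_embed k Nc (T f)"
  using step_range[OF assms(1)] assms(2) by (cases i) (simp_all add: res_def)

lemma res_from_C_points:
  assumes Nc: "Nc \<ge> 1"
  shows "\<exists>e\<in>block_vecs (num_times k Nc). \<forall>i. res Nc e i = C_embed k Nc ((T ^^ i) f)"
proof -
  obtain e where e: "e \<in> block_vecs (num_times k Nc)" "res Nc e 0 = C_embed k Nc f"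
    using A_surj[OF k Nc] by (auto simp: res_def)
  then have "res Nc e i = C_embed k Nc ((T ^^ i) f)" for i
    by (induction i) (simp_all add: res_Suc[OF Nc])
  with e show ?thesis by blast
qed

lemma rnorm_eq:
  assumes "Nc \<ge> 1" "res Nc e i = C_embed k Nc f"
  shows "rnorm Nc e i = bnorm Nc f"
  using bnorm_embed[OF k assms(1), of f] assms(2) by simp

lemma C_embed_eq_0_iff:
  assumes "Nc \<ge> 1"
  shows "C_embed k Nc f = bzero \<longleftrightarrow> bnorm Nc f = 0"
proof
  assume "bnorm Nc f = 0"
  then have "(\<Sum>j<Nc. (norm (f j))\<^sup>2) = 0" by (simp flip: bnorm_sq)
  then have "f J = 0" if "J < Nc" for J
    using that by (simp add: sum_nonneg_eq_0_iff)
  then have "C_embed k Nc f = C_embed k Nc (\<lambda>_. 0)"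
    by (rule C_embed_cong[OF k assms])
  then show "C_embed k Nc f = bzero"
    by (simp add: C_embed_def[of _ _ "\<lambda>_. 0"] bzero_def fun_eq_iff)
next
  assume "C_embed k Nc f = bzero"
  then have "f J = 0" if "J < Nc" for J
    using C_embed_C_point[OF k assms that, of f] by (simp add: bzero_def)
  then show "bnorm Nc f = 0" by (simp add: bnorm_def L2_set_def)
qed

section \<open>Sufficient and necessary conditions for the common iteration\<close>

lemma TAP_0:
  assumes "TAP 1 0"
  shows "D *v v = 0"
  using TAP_D[OF assms, of 0 v] by simp

text \<open>\<open>T_bound\<close> gives the factor \<open>c\<close>, and the slack \<delta> makes
  it strict once \<open>c > 0\<close>. For \<open>c = 0\<close> the matrix \<open>D\<close>, hence
  \<open>T\<close>, would be zero, although the nonzero residual lies in the range of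
  \<open>T\<close>.\<close>

lemma sufficient:
  assumes Nc: "Nc \<ge> 1" and i: "i \<ge> 1" and tap: "TAP 1 c" and \<delta>: "\<delta> > 0" and nz: "res Nc e i \<noteq> bzero"
  shows "rnorm Nc e i > 0" and "rnorm Nc e (Suc i) < c * (1 + \<delta>) * rnorm Nc e i"
proof -
  obtain f where f: "res Nc e i = C_embed k Nc (T f)" using res_range[OF Nc i] by blast
  have r: "rnorm Nc e i = bnorm Nc (T f)" "rnorm Nc e (Suc i) = bnorm Nc (T (T f))"
    by (rule rnorm_eq[OF Nc f]) (rule rnorm_eq[OF Nc res_Suc[OF Nc f]])
  have pos: "bnorm Nc (T f) > 0"
    using nz f C_embed_eq_0_iff[OF Nc, of "T f"] bnorm_nonneg[of Nc "T f"] by simp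
  then show "rnorm Nc e i > 0" using r by simp
  have "c \<noteq> 0"
  proof
    assume "c = 0"
    then have "D *v v = 0" for v using tap TAP_0 by blast
    then have "T f = (\<lambda>_. 0)" by (simp add: T_def shift_def fun_eq_iff)
    then show False using pos by (simp add: bnorm_def L2_set_def)
  qed
  then have "c > 0" using TAP_nonneg[OF tap] by simp
  have "bnorm Nc (T (T f)) \<le> c * bnorm Nc (T f)" by (rule T_bound[OF tap])
  also have "\<dots> < c * bnorm Nc (T f) + c * bnorm Nc (T f) * \<delta>"
    using \<open>c > 0\<close> pos \<delta> by simp
  finally show "rnorm Nc e (Suc i) < c * (1 + \<delta>) * rnorm Nc e i"
    using r by (simp add: algebra_simps)
qed

text \<open>By \<open>T_power_range\<close> every vector shifted by \<open>Suc s * i\<close> occurs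
  as a residual after \<open>i\<close> iterations. A decay bound on the next iteration is thus a
  bound for \<open>T\<close> on shifted vectors, to which \<open>T_lower\<close> applies.\<close>

lemma worst_case_lower:
  assumes inv: "D ** D' = mat 1"
  shows "\<exists>K\<ge>0. \<forall>Nc c. Nc > Suc s * Suc i \<longrightarrow> 0 \<le> c \<longrightarrow>
    (\<forall>e\<in>block_vecs (num_times k Nc). res Nc e i \<noteq> bzero \<longrightarrow> rnorm Nc e (Suc i) \<le> c * rnorm Nc e i) \<longrightarrow>
    TAP 1 (c * (1 + K / real (Nc - Suc s * Suc i)))"
proof -
  define a where "a = Suc s * i"
  have b: "a + Suc s * 1 = Suc s * Suc i" by (simp add: a_def)
  obtain K where K: "K \<ge> 0" and lower: "\<And>n c. n > Suc s * Suc i \<Longrightarrow> 0 \<le> c \<Longrightarrow>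
           (\<And>f. bnorm n (T (shift a f)) \<le> c * bnorm n (shift a f)) \<Longrightarrow>
           TAP 1 (c * (1 + K / real (n - Suc s * Suc i)))"
    using T_lower[of 1 a] unfolding b by auto
  have "TAP 1 (c * (1 + K / real (Nc - Suc s * Suc i)))"
    if Nc: "Nc > Suc s * Suc i" and c: "0 \<le> c"
      and bound: "\<And>e. e \<in> block_vecs (num_times k Nc) \<Longrightarrow> res Nc e i \<noteq> bzero \<Longrightarrow> rnorm Nc e (Suc i) \<le> c * rnorm Nc e i"
    for Nc c
  proof (rule lower[OF Nc c])
    fix f
    have Nc1: "Nc \<ge> 1" using Nc by simp
    obtain g where g: "(T ^^ i) g = shift a f" using T_power_range[OF inv] a_def by metis
    obtain e where e: "e \<in> block_vecs (num_times k Nc)" "\<And>i. res Nc e i = C_embed k Nc ((T ^^ i) g)"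
      using res_from_C_points[OF Nc1] by metis
    have res: "res Nc e i = C_embed k Nc (shift a f)" "res Nc e (Suc i) = C_embed k Nc (T (shift a f))"
      using e(2)[of i] e(2)[of "Suc i"] g by simp_all
    show "bnorm Nc (T (shift a f)) \<le> c * bnorm Nc (shift a f)"
    proof (cases "res Nc e i = bzero")
      case True
      \<comment> \<open>The assumed bound says nothing about zero residuals; here
        \<open>T_bound\<close> with any TAP constant shows that both sides vanish.\<close>
      then have "bnorm Nc (shift a f) = 0" using res(1) C_embed_eq_0_iff[OF Nc1] by metis
      moreover obtain c' where "TAP 1 c'" using TAP_ex by blast
      ultimately show ?thesis using T_bound[of c' Nc "shift a f"] by simp
    next
      case False
      then show ?thesis
        using bound[OF e(1)] rnorm_eq[OF Nc1 res(1)] rnorm_eq[OF Nc1 res(2)] by simp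
    qed
  qed
  with K show ?thesis by blast
qed

text \<open>A supremum below \<open>c / (1 + \<epsilon> Nc)\<close> would give, through
  \<open>worst_case_lower\<close>, a TAP constant smaller than the minimal \<open>c\<close>.\<close>

lemma necessary_ratio:
  assumes inv: "D ** D' = mat 1" "D' ** D = mat 1"
    and tap: "TAP 1 c" and minimal: "\<And>d. TAP 1 d \<Longrightarrow> c \<le> d"
  shows "\<exists>\<epsilon>. inv_sqrt_order \<epsilon> \<and> (\<forall>\<^sub>F Nc in sequentially. ereal (c / (1 + \<epsilon> Nc))
     \<le> (SUP e\<in>{e \<in> block_vecs (num_times k Nc). res Nc e i \<noteq> bzero}. ereal (rnorm Nc e (i + 1) / rnorm Nc e i)))"
proof -
  define b where "b = Suc s * Suc i"
  obtain K where K: "K \<ge> 0" and lower: "\<And>Nc c. Nc > b \<Longrightarrow> 0 \<le> c \<Longrightarrow>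
    (\<And>e. e \<in> block_vecs (num_times k Nc) \<Longrightarrow> res Nc e i \<noteq> bzero \<Longrightarrow> rnorm Nc e (Suc i) \<le> c * rnorm Nc e i) \<Longrightarrow>
    TAP 1 (c * (1 + K / real (Nc - b)))"
    using worst_case_lower[OF inv(1), of i] unfolding b_def by metis
  \<comment> \<open>The numerator \<open>K + 1\<close> instead of \<open>K\<close> makes \<epsilon>
    strictly larger than the loss in \<open>lower\<close>, so that the contradiction is
    strict.\<close>
  obtain \<epsilon> where \<epsilon>: "inv_sqrt_order \<epsilon>" "\<And>n. n > b \<Longrightarrow> \<epsilon> n = (K + 1) / real (n - b)" "\<And>n. n \<le> b \<Longrightarrow> \<epsilon> n = 0"
    using inv_sqrt_order_ex[of "K + 1" 0 b] K by auto
  have "c \<noteq> 0"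
  proof
    assume "c = 0"
    then have "D *v axis undefined 1 = 0" using tap TAP_0 by blast
    then have "D' *v (D *v axis undefined 1) = 0" by simp
    then show False by (simp add: matrix_vector_mul_assoc inv)
  qed
  then have c: "c > 0" using TAP_nonneg[OF tap] by simp
  have "ereal (c / (1 + \<epsilon> Nc))
     \<le> (SUP e\<in>{e \<in> block_vecs (num_times k Nc). res Nc e i \<noteq> bzero}. ereal (rnorm Nc e (i + 1) / rnorm Nc e i))"
    (is "_ \<le> ?sup") if Nc: "Nc > b" for Nc
  proof (rule ccontr)
    assume "\<not> ereal (c / (1 + \<epsilon> Nc)) \<le> ?sup"
    then have sup: "?sup \<le> ereal (c / (1 + \<epsilon> Nc))" by simp
    have \<epsilon>_pos: "\<epsilon> Nc > K / real (Nc - b)" "K / real (Nc - b) \<ge> 0"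
      using Nc K \<epsilon>(2)[OF Nc] by (simp_all add: divide_strict_right_mono)
    have "TAP 1 (c / (1 + \<epsilon> Nc) * (1 + K / real (Nc - b)))"
    proof (rule lower[OF Nc])
      show "0 \<le> c / (1 + \<epsilon> Nc)" using c \<epsilon>_pos by simp
      fix e assume e: "e \<in> block_vecs (num_times k Nc)" "res Nc e i \<noteq> bzero"
      then have "ereal (rnorm Nc e (i + 1) / rnorm Nc e i) \<le> ereal (c / (1 + \<epsilon> Nc))"
        by (intro order_trans[OF SUP_upper sup]) simp
      then have le: "rnorm Nc e (Suc i) / rnorm Nc e i \<le> c / (1 + \<epsilon> Nc)" by simp
      have "rnorm Nc e i \<noteq> 0"
      proof
        assume "rnorm Nc e i = 0"
        then have "(\<Sum>j<num_times k Nc. (norm (res Nc e i j))\<^sup>2) = 0" by (simp flip: bnorm_sq)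
        then have "res Nc e i j = 0" if "j < num_times k Nc" for j
          using that by (simp add: sum_nonneg_eq_0_iff)
        moreover have "res Nc e i j = 0" if "j \<ge> num_times k Nc" for j
          using that by (simp add: res_def system_mat_def bapply_bidiag)
        ultimately have "res Nc e i = bzero"
          unfolding bzero_def by (metis ext not_less)
        then show False using e by simp
      qed
      then have "rnorm Nc e i > 0" using bnorm_nonneg by (simp add: less_le)
      then show "rnorm Nc e (Suc i) \<le> c / (1 + \<epsilon> Nc) * rnorm Nc e i"
        using le by (simp add: pos_divide_le_eq)
    qed
    then have "c \<le> c / (1 + \<epsilon> Nc) * (1 + K / real (Nc - b))" by (rule minimal)
    then have "c * (1 + \<epsilon> Nc) \<le> c * (1 + K / real (Nc - b))"
      using \<epsilon>_pos by (simp add: field_simps)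
    then show False using c \<epsilon>_pos by simp
  qed
  then show ?thesis
    by (intro exI[of _ \<epsilon>] conjI \<epsilon>(1) eventually_mono[OF eventually_gt_at_top[of b]])
qed

text \<open>Decrease is a decay bound with constant one, so \<open>worst_case_lower\<close> makes
  \<open>1 + K / (Nc - b)\<close> a TAP constant, and the minimal \<open>c\<close> cannot exceed
  it.\<close>

lemma necessary_decrease:
  assumes inv: "D ** D' = mat 1" and tap: "TAP 1 c" and minimal: "\<And>d. TAP 1 d \<Longrightarrow> c \<le> d"
  shows "\<exists>\<epsilon>. inv_sqrt_order \<epsilon> \<and> (\<forall>Nc\<ge>1.
     (\<forall>e\<in>{e \<in> block_vecs (num_times k Nc). res Nc e i \<noteq> bzero}. rnorm Nc e (i + 1) < rnorm Nc e i)
     \<longrightarrow> c < 1 + \<epsilon> Nc)"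
proof -
  define b where "b = Suc s * Suc i"
  obtain K where K: "K \<ge> 0" and lower: "\<And>Nc c. Nc > b \<Longrightarrow> 0 \<le> c \<Longrightarrow>
    (\<And>e. e \<in> block_vecs (num_times k Nc) \<Longrightarrow> res Nc e i \<noteq> bzero \<Longrightarrow> rnorm Nc e (Suc i) \<le> c * rnorm Nc e i) \<Longrightarrow>
    TAP 1 (c * (1 + K / real (Nc - b)))"
    using worst_case_lower[OF inv(1), of i] unfolding b_def by metis
  \<comment> \<open>On grids too short for \<open>lower\<close> the value \<open>c\<close> makes
    \<open>c < 1 + \<epsilon> Nc\<close> trivial.\<close>
  obtain \<epsilon> where \<epsilon>: "inv_sqrt_order \<epsilon>" "\<And>n. n > b \<Longrightarrow> \<epsilon> n = (K + 1) / real (n - b)" "\<And>n. n \<le> b \<Longrightarrow> \<epsilon> n = c"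
    using inv_sqrt_order_ex[of "K + 1" c b] K TAP_nonneg[OF tap] by auto
  have "c < 1 + \<epsilon> Nc"
    if dec: "\<forall>e\<in>{e \<in> block_vecs (num_times k Nc). res Nc e i \<noteq> bzero}. rnorm Nc e (i + 1) < rnorm Nc e i" for Nc
  proof (cases "Nc > b")
    case True
    have "TAP 1 (1 * (1 + K / real (Nc - b)))"
      by (rule lower[OF True]) (use dec in \<open>auto intro: less_imp_le\<close>)
    then have "c \<le> 1 + K / real (Nc - b)" using minimal by simp
    also have "\<dots> < 1 + \<epsilon> Nc" using \<epsilon>(2)[OF True] True by (simp add: divide_strict_right_mono)
    finally show ?thesis .
  qed (use \<epsilon>(3) in simp)
  with \<epsilon>(1) show ?thesis by blast
qed

text \<open>The iterations are counted from the start, where every coarse vector is available as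
  residual. So \<open>T_lower\<close> applies to the \<open>p\<close>-th power with offset
  zero.\<close>

lemma necessary_power:
  assumes comm: "D ** \<Psi> = \<Psi> ** D" "D ** G = G ** D"
  shows "\<exists>\<epsilon>. inv_sqrt_order \<epsilon> \<and> (\<forall>Nc\<ge>1.
     (\<forall>e\<in>block_vecs (num_times k Nc). e \<noteq> bzero \<longrightarrow> rnorm Nc e p < rnorm Nc e 0)
     \<longrightarrow> (\<exists>c. c < 1 + \<epsilon> Nc \<and> TAP p c))"
proof -
  define b where "b = Suc s * p"
  obtain K where K: "K \<ge> 0" and lower: "\<And>n c. n > b \<Longrightarrow> 0 \<le> c \<Longrightarrow>
           (\<And>f. bnorm n ((T ^^ p) f) \<le> c * bnorm n f) \<Longrightarrow> TAP p (c * (1 + K / real (n - b)))"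
    using T_lower[of p 0] comm unfolding b_def by auto
  obtain c where c: "c \<ge> 0" "TAP p c" using TAP_ex by blast
  obtain \<epsilon> where \<epsilon>: "inv_sqrt_order \<epsilon>" "\<And>n. n > b \<Longrightarrow> \<epsilon> n = (K + 1) / real (n - b)" "\<And>n. n \<le> b \<Longrightarrow> \<epsilon> n = c"
    using inv_sqrt_order_ex[of "K + 1" c b] K c by auto
  have "\<exists>c. c < 1 + \<epsilon> Nc \<and> TAP p c"
    if Nc: "Nc \<ge> 1" and dec: "\<And>e. e \<in> block_vecs (num_times k Nc) \<Longrightarrow> e \<noteq> bzero \<Longrightarrow> rnorm Nc e p < rnorm Nc e 0" for Nc
  proof (cases "Nc > b")
    case True
    have "TAP p (1 * (1 + K / real (Nc - b)))"
    proof (rule lower[OF True])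
      fix f
      obtain e where e: "e \<in> block_vecs (num_times k Nc)" "\<And>i. res Nc e i = C_embed k Nc ((T ^^ i) f)"
        using res_from_C_points[OF Nc] by metis
      \<comment> \<open>Strict decrease is assumed for nonzero errors only; the zero error keeps a
        zero residual.\<close>
      have "rnorm Nc e p \<le> rnorm Nc e 0"
      proof (cases "e = bzero")
        case True
        have z: "bapply n X bzero = bzero" for n and X :: "'n bmat"
          by (simp add: bapply_def bzero_def)
        have "(bapply (num_times k Nc) (E Nc) ^^ p) bzero = bzero"
          by (induction p) (simp_all add: z)
        then show ?thesis using True by (simp add: res_def z)
      qed (use dec[OF e(1)] in simp)
      then show "bnorm Nc ((T ^^ p) f) \<le> 1 * bnorm Nc f"
        using rnorm_eq[OF Nc e(2)[of p]] rnorm_eq[OF Nc e(2)[of 0]] by simp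
    qed simp
    moreover have "1 + K / real (Nc - b) < 1 + \<epsilon> Nc"
      using \<epsilon>(2)[OF True] True by (simp add: divide_strict_right_mono)
    ultimately show ?thesis by (metis mult_1)
  next
    case False
    then show ?thesis using \<epsilon>(3)[of Nc] c by (intro exI[of _ c]) simp
  qed
  with \<epsilon>(1) show ?thesis by blast
qed

end

section \<open>Instantiation for F- and FCF-relaxation\<close>

lemma matrix_diff_commute:
  fixes A B C :: "complex^'n^'n"
  assumes "A ** C = C ** A" "B ** C = C ** B"
  shows "(A - B) ** C = C ** (A - B)"
proof -
  have "A *v (C *v v) = C *v (A *v v)" "B *v (C *v v) = C *v (B *v v)" for v
    by (simp_all add: matrix_vector_mul_assoc assms)
  then have "(A - B) *v (C *v v) = C *v ((A - B) *v v)" for v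
    by (simp add: matrix_vector_mult_diff_rdistrib matrix_vector_mult_diff_distrib)
  then show ?thesis by (simp add: matrix_eq flip: matrix_vector_mul_assoc)
qed

theorem theorem2p2:
  fixes \<Phi> \<Psi> :: "complex^'n^'n" and k q :: nat and \<phi>F \<phi>FCF :: real
  assumes "invertible \<Phi>" and "invertible \<Psi>"
    and "q \<ge> 1" and "opnorm (matpow \<Phi> q) < 1" and "opnorm (matpow \<Psi> q) < 1"
    and "k \<ge> 2"
    and "F_TAP 1 k \<Phi> \<Psi> \<phi>F" and "FCF_TAP 1 k \<Phi> \<Psi> \<phi>FCF"
  shows
    "(\<forall>Nc\<ge>1.
        (\<forall>i>1. \<forall>e0\<in>starts_F k Nc \<Phi> \<Psi> i.
           res_ratio_F k Nc \<Phi> \<Psi> i e0 = err_ratio_F k Nc \<Phi> \<Psi> i e0 \<and>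
           err_ratio_F k Nc \<Phi> \<Psi> i e0 < \<phi>F * (1 + opnorm (matpow \<Psi> Nc))) \<and>
        (\<forall>i>1. \<forall>e0\<in>starts_FCF k Nc \<Phi> \<Psi> i.
           res_ratio_FCF k Nc \<Phi> \<Psi> i e0 = err_ratio_FCF k Nc \<Phi> \<Psi> i e0 \<and>
           err_ratio_FCF k Nc \<Phi> \<Psi> i e0
             < \<phi>FCF * (1 + opnorm (matpow (matrix_inv \<Phi>) k ** matpow \<Psi> Nc ** matpow \<Phi> k))) \<and>
        (\<phi>F * (1 + opnorm (matpow \<Psi> Nc)) < 1 \<longrightarrow>
           (\<forall>i\<ge>1. \<forall>e0\<in>starts_F k Nc \<Phi> \<Psi> i.
              norm_AA k Nc \<Phi> (err_F k Nc \<Phi> \<Psi> e0 (i + 1)) < norm_AA k Nc \<Phi> (err_F k Nc \<Phi> \<Psi> e0 i))) \<and>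
        (\<phi>FCF * (1 + opnorm (matpow (matrix_inv \<Phi>) k ** matpow \<Psi> Nc ** matpow \<Phi> k)) < 1 \<longrightarrow>
           (\<forall>i\<ge>1. \<forall>e0\<in>starts_FCF k Nc \<Phi> \<Psi> i.
              norm_AA k Nc \<Phi> (err_FCF k Nc \<Phi> \<Psi> e0 (i + 1))
                < norm_AA k Nc \<Phi> (err_FCF k Nc \<Phi> \<Psi> e0 i)))) \<and>
     (invertible (\<Psi> - matpow \<Phi> k) \<and>
      (\<forall>c. F_TAP 1 k \<Phi> \<Psi> c \<longrightarrow> \<phi>F \<le> c) \<and> (\<forall>c. FCF_TAP 1 k \<Phi> \<Psi> c \<longrightarrow> \<phi>FCF \<le> c) \<longrightarrow>
        (\<forall>i>1.
           (\<forall>Nc\<ge>1. (SUP e0\<in>starts_F k Nc \<Phi> \<Psi> i. ereal (res_ratio_F k Nc \<Phi> \<Psi> i e0))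
                     = (SUP e0\<in>starts_F k Nc \<Phi> \<Psi> i. ereal (err_ratio_F k Nc \<Phi> \<Psi> i e0))) \<and>
           (\<forall>Nc\<ge>1. (SUP e0\<in>starts_FCF k Nc \<Phi> \<Psi> i. ereal (res_ratio_FCF k Nc \<Phi> \<Psi> i e0))
                     = (SUP e0\<in>starts_FCF k Nc \<Phi> \<Psi> i. ereal (err_ratio_FCF k Nc \<Phi> \<Psi> i e0))) \<and>
           (\<exists>\<epsilon>. inv_sqrt_order \<epsilon> \<and>
              (\<forall>\<^sub>F Nc in sequentially. ereal (\<phi>F / (1 + \<epsilon> Nc))
                 \<le> (SUP e0\<in>starts_F k Nc \<Phi> \<Psi> i. ereal (res_ratio_F k Nc \<Phi> \<Psi> i e0)))) \<and>
           (\<exists>\<epsilon>. inv_sqrt_order \<epsilon> \<and>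
              (\<forall>\<^sub>F Nc in sequentially. ereal (\<phi>FCF / (1 + \<epsilon> Nc))
                 \<le> (SUP e0\<in>starts_FCF k Nc \<Phi> \<Psi> i. ereal (res_ratio_FCF k Nc \<Phi> \<Psi> i e0))))) \<and>
        (\<forall>i\<ge>1.
           (\<exists>\<epsilon>. inv_sqrt_order \<epsilon> \<and>
              (\<forall>Nc\<ge>1.
                 (\<forall>e0\<in>starts_F k Nc \<Phi> \<Psi> i.
                    norm_AA k Nc \<Phi> (err_F k Nc \<Phi> \<Psi> e0 (i + 1))
                      < norm_AA k Nc \<Phi> (err_F k Nc \<Phi> \<Psi> e0 i))
                 \<longrightarrow> \<phi>F < 1 + \<epsilon> Nc)) \<and>
           (\<exists>\<epsilon>. inv_sqrt_order \<epsilon> \<and>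
              (\<forall>Nc\<ge>1.
                 (\<forall>e0\<in>starts_FCF k Nc \<Phi> \<Psi> i.
                    norm_AA k Nc \<Phi> (err_FCF k Nc \<Phi> \<Psi> e0 (i + 1))
                      < norm_AA k Nc \<Phi> (err_FCF k Nc \<Phi> \<Psi> e0 i))
                 \<longrightarrow> \<phi>FCF < 1 + \<epsilon> Nc)))) \<and>
     (\<Phi> ** \<Psi> = \<Psi> ** \<Phi> \<and>
      (invertible (\<Psi> - matpow \<Phi> k) \<or> diagonalizable \<Phi> \<and> diagonalizable \<Psi>) \<longrightarrow>
        (\<forall>p\<ge>1.
           (\<exists>\<epsilon>. inv_sqrt_order \<epsilon> \<and>
              (\<forall>Nc\<ge>1.
                 (\<forall>e0\<in>block_vecs (num_times k Nc). e0 \<noteq> bzero \<longrightarrow>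
                    norm_AA k Nc \<Phi> (err_F k Nc \<Phi> \<Psi> e0 p) < norm_AA k Nc \<Phi> e0)
                 \<longrightarrow> (\<exists>\<phi>. \<phi> < 1 + \<epsilon> Nc \<and> F_TAP p k \<Phi> \<Psi> \<phi>))) \<and>
           (\<exists>\<epsilon>. inv_sqrt_order \<epsilon> \<and>
              (\<forall>Nc\<ge>1.
                 (\<forall>e0\<in>block_vecs (num_times k Nc). e0 \<noteq> bzero \<longrightarrow>
                    norm_AA k Nc \<Phi> (err_FCF k Nc \<Phi> \<Psi> e0 p) < norm_AA k Nc \<Phi> e0)
                 \<longrightarrow> (\<exists>\<phi>. \<phi> < 1 + \<epsilon> Nc \<and> FCF_TAP p k \<Phi> \<Psi> \<phi>)))))"
proof -
  define D where "D = \<Psi> - matpow \<Phi> k"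
  define \<Phi>k \<Phi>k' where "\<Phi>k = matpow \<Phi> k" and "\<Phi>k' = matpow (matrix_inv \<Phi>) k"
  note k = \<open>k \<ge> 2\<close>
  have inv: "\<Phi>k' ** \<Phi>k = mat 1" "\<Phi>k ** \<Phi>k' = mat 1"
    unfolding \<Phi>k_def \<Phi>k'_def by (intro matpow_left_inverse matrix_inv_mult assms)+
  interpret mF: residual_map \<Psi> D "mat 1" "mat 1" 0 q
    by unfold_locales (use assms in auto)
  interpret mFCF: residual_map \<Psi> D \<Phi>k' \<Phi>k 1 q
    by unfold_locales (use assms inv in auto)
  have TF: "relax k Nc \<Phi> (Mcgc_inv k Nc \<Phi> \<Psi>) (C_embed k Nc f) = C_embed k Nc (mF.T f)" if "Nc \<ge> 1" for Nc f
    using coarse_correction[OF k that, of \<Phi> \<Psi> f, folded D_def] by (simp add: mF.T_def)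
  \<comment> \<open>The additional C- and F-sweeps act as \<open>\<Phi>k\<close> after a shift;
    composed with the F-operator they give the FCF-operator.\<close>
  have TFCF: "mF.T (\<lambda>J. \<Phi>k *v shift 1 f J) = mFCF.T f" for f
    unfolding mF.T_def mFCF.T_def by simp
  interpret F: error_iteration \<Psi> D "mat 1" "mat 1" 0 q k \<Phi> "\<lambda>Nc. E_F k Nc \<Phi> \<Psi>"
  proof
    fix Nc e assume Nc: "(1::nat) \<le> Nc"
    show "\<exists>f. bapply (num_times k Nc) (system_mat k Nc \<Phi>) (bapply (num_times k Nc) (E_F k Nc \<Phi> \<Psi>) e) = C_embed k Nc (mF.T f)"
      using F_relax_ex[OF k Nc, of \<Phi> e] by (auto simp: residual_E_F[OF k Nc] TF[OF Nc])
    fix f assume "bapply (num_times k Nc) (system_mat k Nc \<Phi>) e = C_embed k Nc f"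
    then show "bapply (num_times k Nc) (system_mat k Nc \<Phi>) (bapply (num_times k Nc) (E_F k Nc \<Phi> \<Psi>) e) = C_embed k Nc (mF.T f)"
      by (simp add: residual_E_F[OF k Nc] F_relax_embed[OF k Nc] TF[OF Nc])
  qed (rule k)
  interpret FCF: error_iteration \<Psi> D \<Phi>k' \<Phi>k 1 q k \<Phi> "\<lambda>Nc. E_FCF k Nc \<Phi> \<Psi>"
  proof
    fix Nc e assume Nc: "(1::nat) \<le> Nc"
    have step: "bapply (num_times k Nc) (system_mat k Nc \<Phi>) (bapply (num_times k Nc) (E_FCF k Nc \<Phi> \<Psi>) e) = C_embed k Nc (mFCF.T f)"
      if "relax k Nc \<Phi> (MF_inv k Nc \<Phi>) (bapply (num_times k Nc) (system_mat k Nc \<Phi>) e) = C_embed k Nc f" for f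
      unfolding residual_E_FCF[OF k Nc] that C_relax[OF k Nc] TF[OF Nc] \<Phi>k_def[symmetric] TFCF ..
    show "\<exists>f. bapply (num_times k Nc) (system_mat k Nc \<Phi>) (bapply (num_times k Nc) (E_FCF k Nc \<Phi> \<Psi>) e) = C_embed k Nc (mFCF.T f)"
      using F_relax_ex[OF k Nc, of \<Phi> e] step by blast
    fix f assume "bapply (num_times k Nc) (system_mat k Nc \<Phi>) e = C_embed k Nc f"
    then show "bapply (num_times k Nc) (system_mat k Nc \<Phi>) (bapply (num_times k Nc) (E_FCF k Nc \<Phi> \<Psi>) e) = C_embed k Nc (mFCF.T f)"
      by (intro step) (simp add: F_relax_embed[OF k Nc])
  qed (rule k)
  have TAP_F: "F_TAP p k \<Phi> \<Psi> c \<longleftrightarrow> mF.TAP p c" for p c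
    unfolding F_TAP_def mF.TAP_def mF.symb_def by (simp add: D_def)
  have TAP_FCF: "FCF_TAP p k \<Phi> \<Psi> c \<longleftrightarrow> mFCF.TAP p c" for p c
    unfolding FCF_TAP_def mFCF.TAP_def mFCF.symb_def by (simp add: D_def \<Phi>k'_def)
  have res: "res_F k Nc \<Phi> \<Psi> e i = F.res Nc e i" "res_FCF k Nc \<Phi> \<Psi> e i = FCF.res Nc e i" for Nc e i
    by (simp_all add: res_F_def F.res_def err_F_def res_FCF_def FCF.res_def err_FCF_def)
  have AA: "norm_AA k Nc \<Phi> (err_F k Nc \<Phi> \<Psi> e i) = F.rnorm Nc e i"
    "norm_AA k Nc \<Phi> (err_FCF k Nc \<Phi> \<Psi> e i) = FCF.rnorm Nc e i" for Nc e i
    by (simp_all add: norm_AA_eq res_F_def[symmetric] res_FCF_def[symmetric] res)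
  have AA0: "norm_AA k Nc \<Phi> e = F.rnorm Nc e 0" "norm_AA k Nc \<Phi> e = FCF.rnorm Nc e 0" for Nc e
    by (simp_all add: norm_AA_eq F.res_def FCF.res_def)
  have starts: "starts_F k Nc \<Phi> \<Psi> i = {e \<in> block_vecs (num_times k Nc). F.res Nc e i \<noteq> bzero}"
    "starts_FCF k Nc \<Phi> \<Psi> i = {e \<in> block_vecs (num_times k Nc). FCF.res Nc e i \<noteq> bzero}" for Nc i
    by (simp_all add: starts_F_def starts_FCF_def res)
  have ratio: "res_ratio_F k Nc \<Phi> \<Psi> i e = F.rnorm Nc e (i + 1) / F.rnorm Nc e i"
    "err_ratio_F k Nc \<Phi> \<Psi> i e = F.rnorm Nc e (i + 1) / F.rnorm Nc e i"
    "res_ratio_FCF k Nc \<Phi> \<Psi> i e = FCF.rnorm Nc e (i + 1) / FCF.rnorm Nc e i"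
    "err_ratio_FCF k Nc \<Phi> \<Psi> i e = FCF.rnorm Nc e (i + 1) / FCF.rnorm Nc e i" for Nc i e
    by (simp_all add: res_ratio_F_def err_ratio_F_def res_ratio_FCF_def err_ratio_FCF_def res AA)
  have tapF: "mF.TAP 1 \<phi>F" and tapFCF: "mFCF.TAP 1 \<phi>FCF"
    using assms by (simp_all add: TAP_F TAP_FCF)
  \<comment> \<open>Invertibility of \<Psi> makes the two norms added to one positive; they are the
    slack \<delta> of \<open>sufficient\<close>.\<close>
  have \<Psi>_inv: "matpow (matrix_inv \<Psi>) m ** matpow \<Psi> m = mat 1" for m
    by (intro matpow_left_inverse matrix_inv_mult assms)
  have posF: "opnorm (matpow \<Psi> Nc) > 0" for Nc
    using \<Psi>_inv by (rule opnorm_pos)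
  have posFCF: "opnorm (\<Phi>k' ** matpow \<Psi> Nc ** \<Phi>k) > 0" for Nc
  proof (rule opnorm_pos)
    have "\<Phi>k' ** matpow (matrix_inv \<Psi>) Nc ** \<Phi>k ** (\<Phi>k' ** matpow \<Psi> Nc ** \<Phi>k)
        = \<Phi>k' ** matpow (matrix_inv \<Psi>) Nc ** (\<Phi>k ** \<Phi>k') ** matpow \<Psi> Nc ** \<Phi>k"
      by (simp add: matrix_mul_assoc)
    also have "\<dots> = \<Phi>k' ** (matpow (matrix_inv \<Psi>) Nc ** matpow \<Psi> Nc) ** \<Phi>k"
      by (simp add: inv matrix_mul_assoc)
    finally show "\<Phi>k' ** matpow (matrix_inv \<Psi>) Nc ** \<Phi>k ** (\<Phi>k' ** matpow \<Psi> Nc ** \<Phi>k) = mat 1"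
      by (simp add: \<Psi>_inv inv)
  qed
  have suffF: "F.rnorm Nc e i > 0" "F.rnorm Nc e (i + 1) < \<phi>F * (1 + opnorm (matpow \<Psi> Nc)) * F.rnorm Nc e i"
    if "Nc \<ge> 1" "i \<ge> 1" "F.res Nc e i \<noteq> bzero" for Nc e i
    using F.sufficient[OF that(1,2) tapF posF[of Nc] that(3)] by simp_all
  have suffFCF: "FCF.rnorm Nc e i > 0"
    "FCF.rnorm Nc e (i + 1) < \<phi>FCF * (1 + opnorm (\<Phi>k' ** matpow \<Psi> Nc ** \<Phi>k)) * FCF.rnorm Nc e i"
    if "Nc \<ge> 1" "i \<ge> 1" "FCF.res Nc e i \<noteq> bzero" for Nc e i
    using FCF.sufficient[OF that(1,2) tapFCF posFCF[of Nc] that(3)] by simp_all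
  have shrink: "x < y" if "x < c * y" "c < 1" "y > 0" for x y c :: real
    using that by (smt (verit) mult_less_cancel_right2)
  have commute: "D ** \<Psi> = \<Psi> ** D" "D ** \<Phi>k' = \<Phi>k' ** D" if c: "\<Phi> ** \<Psi> = \<Psi> ** \<Phi>"
  proof -
    have \<Phi>k: "\<Phi>k ** \<Psi> = \<Psi> ** \<Phi>k"
      unfolding \<Phi>k_def by (rule matpow_commute[OF c])
    then show "D ** \<Psi> = \<Psi> ** D"
      unfolding D_def \<Phi>k_def by (intro matrix_diff_commute refl)
    have "\<Psi> ** \<Phi>k' = \<Phi>k' ** \<Psi>"
      by (rule inverse_commute[OF inv(2,1) \<Phi>k, symmetric])
    then show "D ** \<Phi>k' = \<Phi>k' ** D"
      unfolding D_def \<Phi>k_def[symmetric] by (intro matrix_diff_commute) (simp_all add: inv)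
  qed
  note D_inv = matrix_inv_mult[of D]
  show ?thesis
    unfolding starts ratio AA
    unfolding AA0(1) TAP_F TAP_FCF \<Phi>k_def[symmetric] \<Phi>k'_def[symmetric] D_def[unfolded \<Phi>k_def[symmetric], symmetric]
  proof (intro conjI allI impI ballI, goal_cases)
    case (1 Nc i e)
    then show ?case by simp
  next
    case (2 Nc i e)
    then show ?case using suffF[of Nc i e] by (simp add: pos_divide_less_eq)
  next
    case (3 Nc i e)
    then show ?case by simp
  next
    case (4 Nc i e)
    then show ?case using suffFCF[of Nc i e] by (simp add: pos_divide_less_eq)
  next
    case (5 Nc i e)
    then show ?case using suffF[of Nc i e] by (intro shrink[OF suffF(2)]) auto
  next
    case (6 Nc i e)
    then show ?case using suffFCF[of Nc i e] by (intro shrink[OF suffFCF(2)]) auto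
  next
    case (7 i Nc)
    then show ?case by simp
  next
    case (8 i Nc)
    then show ?case by simp
  next
    case (9 i)
    then show ?case using F.necessary_ratio[OF D_inv tapF, of i] by blast
  next
    case (10 i)
    then show ?case using FCF.necessary_ratio[OF D_inv tapFCF, of i] by blast
  next
    case (11 i)
    then show ?case using F.necessary_decrease[OF D_inv(1) tapF, of i] by blast
  next
    case (12 i)
    then show ?case using FCF.necessary_decrease[OF D_inv(1) tapFCF, of i] by blast
  next
    case (13 p)
    then show ?case using F.necessary_power[of p] commute by simp
  next
    case (14 p)
    \<comment> \<open>The initial norm was rewritten above in terms of the F-iteration;
      \<open>AA0\<close> brings it and its FCF counterpart back to the common form.\<close>
    then show ?case using FCF.necessary_power[of p] commute by (simp add: AA0[symmetric])
  qed
qed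

end
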